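(* Let $p, q$ be distinct odd primes and let $\alpha,\beta$ be positive integers. Then $$Z(p^{\alpha}q^{\beta})\equiv 2(2-q)\left(1-\frac{1}{q^{3}}\right)p^{\alpha-1}q^{\beta-1}B_{p-3}\pmod{p^{\alpha}}.$$
   Context: For a positive integer $n$, let $\mathcal{P}_n$ denote the set of positive integers which are prime to $n$, and define the rational number $$Z(n)=\sum_{\substack{i+j+k=n\\ i,j,k\in\mathcal{P}_n}}\frac{1}{ijk},$$ the sum being over ordered triples $(i,j,k)$. The Bernoulli numbers $B_k$ are defined by $B_0=1$ and the recursion $\sum_{i=0}^{n}\binom{n+1}{i}B_i=0$ for $n\ge 1$. A congruence modulo $p^{\alpha}$ between rational numbers whose denominators are prime to $p$ means that the numerator of their difference, in lowest terms, is divisible by $p^{\alpha}$. *)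

theory Defs
  imports Complex_Main "HOL-Computational_Algebra.Primes"
begin

definition prime_to :: "nat \<Rightarrow> nat set" where
  "prime_to n = {m. m > 0 \<and> coprime m n}"

definition Z :: "nat \<Rightarrow> rat" where
  "Z n = (\<Sum>(i, j, k) \<in> {(i, j, k). i \<in> prime_to n \<and> j \<in> prime_to n \<and> k \<in> prime_to n
            \<and> i + j + k = n}. 1 / (of_nat i * of_nat j * of_nat k))"

text \<open>The index set is finite, so the sum above is never the default value of an infinite sum.\<close>

lemma finite_Z_index:
  "finite {(i, j, k). i \<in> prime_to n \<and> j \<in> prime_to n \<and> k \<in> prime_to n \<and> i + j + k = n}"
  by (rule finite_subset[of _ "{..n} \<times> {..n} \<times> {..n}"]) auto

context
  notes sum.cong [fundef_cong]
begin

fun bernoulli :: "nat \<Rightarrow> rat" where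
  "bernoulli 0 = 1"
| "bernoulli (Suc n) =
     - (\<Sum>i\<le>n. of_nat ((n + 2) choose i) * bernoulli i) / of_nat (n + 2)"

end

text \<open>The defining equation solves the usual recursion for its last term.\<close>

lemma bernoulli_recursion:
  assumes "n \<ge> 1"
  shows "(\<Sum>i\<le>n. of_nat ((n + 1) choose i) * bernoulli i) = 0"
proof -
  obtain m where n: "n = Suc m"
    using assms by (cases n) auto
  have "(of_nat (m + 2) :: rat) \<noteq> 0"
    by (simp del: of_nat_add)
  moreover have "(Suc (Suc m)) choose (Suc m) = m + 2"
    by (simp add: binomial_symmetric[of "Suc m"])
  ultimately show ?thesis
    unfolding n by (simp del: of_nat_add binomial_Suc_Suc)
qed

text \<open>
  \<^term>\<open>quotient_of\<close> returns numerator and (positive) denominator in lowest terms.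
  The congruence is only meaningful for rationals with denominators prime to \<open>p\<close>,
  so this is part of what it asserts.
\<close>

definition rat_cong_prime_power :: "nat \<Rightarrow> nat \<Rightarrow> rat \<Rightarrow> rat \<Rightarrow> bool" where
  "rat_cong_prime_power p a x y \<longleftrightarrow>
     coprime (snd (quotient_of x)) (int p) \<and> coprime (snd (quotient_of y)) (int p) \<and>
     int p ^ a dvd fst (quotient_of (x - y))"

end

theory Submission
  imports Defs "HOL-Number_Theory.Residues"
begin

text \<open>
  Since \<open>i + j + k = n\<close>, the summand \<open>1 / (i j k)\<close> equals \<open>1 / n\<close> times
  \<open>1 / (i j) + 1 / (j k) + 1 / (k i)\<close>, and \<open>1 / (i j) = 1 / (i (i + j)) + 1 / (j (i + j))\<close>.
  Hence \<open>n Z(n) = 3 X(n)\<close> exactly, where \<open>X(n)\<close> is the sum of \<open>1 / (i l)\<close> over the ordered pairs of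
  units \<open>i, l < n\<close> whose difference is again a unit modulo \<open>n\<close> (\<open>n_times_Z\<close>).
  The condition on the pair only depends on residues modulo the primes dividing \<open>n\<close>, which makes
  \<open>X\<close> easier to evaluate \<open>p\<close>-adically than \<open>Z\<close>; the price is the denominator \<open>n\<close>, so
  \<open>3 X(n)\<close> is needed modulo \<open>p\<^bsup>2\<alpha>\<^esup>\<close> to get \<open>Z(n)\<close> modulo \<open>p\<^sup>\<alpha>\<close>.

  Put \<open>m = p q\<close> and \<open>N = p\<^bsup>\<alpha>-1\<^esup> q\<^bsup>\<beta>-1\<^esup>\<close>.  Grouping the units below \<open>m N\<close> by their residue \<open>w\<close>
  modulo \<open>m\<close> expresses \<open>X(m N)\<close> through the sums of \<open>1 / (w + m t)\<close> over \<open>t < N\<close>.  Three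
  times such a sum is congruent modulo \<open>p\<^bsup>\<alpha>+1\<^esup>\<close> to three times \<open>N (1 / w - e / w\<^sup>2)\<close> with \<open>e\<close>
  divisible by \<open>p\<close> and independent of \<open>w\<close> (\<open>sum_inverse_progression\<close>), and the terms of \<open>X(m N)\<close>
  linear in \<open>e\<close> cancel modulo \<open>p\<^bsup>2\<alpha>\<^esup>\<close> under \<open>w \<mapsto> m - w\<close>.
  So \<open>Z(m N) \<equiv> N Z(m)\<close> modulo \<open>p\<^sup>\<alpha>\<close> (\<open>Z_mult_cong\<close>), which leaves \<open>Z(p q)\<close> modulo \<open>p\<close>.

  The units below \<open>p q\<close> form a \<open>(p - 1) \<times> (q - 1)\<close> grid by the Chinese remainder theorem, and \<open>X(p q)\<close>
  runs over pairs of cells in different rows and different columns.  Inclusion and exclusion turns it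
  into squares of row sums and column sums; modulo \<open>p\<^sup>2\<close> only the squares of the row sums and of the single
  entries survive, and they give \<open>(2 - q) (q - 1 / q\<^sup>2) H\<close> with \<open>H\<close> the sum of \<open>1 / r\<^sup>2\<close> over \<open>0 < r < p\<close>
  (\<open>unit_pair_sum_prime_product_cong\<close>).

  Finally \<open>3 H \<equiv> 2 p B\<^bsub>p-3\<^esub>\<close> modulo \<open>p\<^sup>2\<close> (\<open>inverse_square_sum_cong\<close>).  The identity \<open>n Z(n) = 3 X(n)\<close>
  at \<open>n = p\<close> reads \<open>p Z(p) \<equiv> - 3 H\<close> modulo \<open>p\<^sup>2\<close>, so only \<open>Z(p)\<close> modulo \<open>p\<close> is required; there \<open>k \<equiv> - (i + j)\<close>
  reduces it to the sum of \<open>1 / (i l\<^sup>2)\<close> over \<open>i < l\<close>, which Fermat's little theorem and the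
  formula for sums of powers evaluate to \<open>B\<^bsub>p-3\<^esub>\<close>.

  The factor 3 is carried along throughout instead of being divided out: it absorbs the denominators 3
  that would otherwise spoil the argument when \<open>p = 3\<close>.
\<close>

section \<open>Divisibility of rational numbers by powers of an odd prime\<close>

locale odd_prime =
  fixes p :: nat
  assumes prime_p: "prime p" and odd_p: "odd p"
begin

lemma p_gt_2: "p > 2"
  using prime_p odd_p prime_ge_2_nat[of p] by (cases "p = 2") auto

text \<open>The fractional ideal \<open>p\<^sup>a \<int>\<^bsub>(p)\<^esub>\<close>: membership of \<open>x - y\<close> is the congruence modulo \<open>p\<^sup>a\<close>.\<close>

definition I :: "nat \<Rightarrow> rat set" where
  "I a = {of_nat p ^ a * of_int u / of_int v | u v. coprime v (int p)}"

lemma coprime_p_nonzero: "coprime v (int p) \<Longrightarrow> v \<noteq> 0"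
  using p_gt_2 by auto

lemma I_I:
  assumes "coprime v (int p)" and "x * of_int v = of_nat p ^ a * of_int u"
  shows "x \<in> I a"
proof -
  have "x = of_nat p ^ a * of_int u / of_int v"
    using assms coprime_p_nonzero[OF assms(1)] by (simp add: field_simps)
  then show ?thesis
    unfolding I_def using assms(1) by blast
qed

lemma I_E:
  assumes "x \<in> I a"
  obtains u v where "coprime v (int p)" and "v \<noteq> 0" and "x = of_nat p ^ a * of_int u / of_int v"
  using assms coprime_p_nonzero unfolding I_def by blast

lemma zero_in_I [simp]: "0 \<in> I a"
  by (rule I_I[of 1 _ _ 0]) auto

lemma I_uminus:
  assumes "x \<in> I a"
  shows "- x \<in> I a"
proof -
  obtain u v where 1: "coprime v (int p)" "v \<noteq> 0" "x = of_nat p ^ a * of_int u / of_int v"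
    using assms by (rule I_E)
  have "- x * of_int v = of_nat p ^ a * of_int (- u)"
    unfolding 1(3) using 1(2) by simp
  with 1(1) show ?thesis
    by (rule I_I)
qed

lemma I_add:
  assumes "x \<in> I a" and "y \<in> I a"
  shows "x + y \<in> I a"
proof -
  obtain u v where 1: "coprime v (int p)" "v \<noteq> 0" "x = of_nat p ^ a * of_int u / of_int v"
    using assms(1) by (rule I_E)
  obtain u' v' where 2: "coprime v' (int p)" "v' \<noteq> 0" "y = of_nat p ^ a * of_int u' / of_int v'"
    using assms(2) by (rule I_E)
  show ?thesis
  proof (rule I_I)
    show "coprime (v * v') (int p)"
      using 1 2 by simp
    show "(x + y) * of_int (v * v') = of_nat p ^ a * of_int (u * v' + u' * v)"
      unfolding 1(3) 2(3) using 1(2) 2(2) by (simp add: field_simps)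
  qed
qed

lemma I_diff: "x \<in> I a \<Longrightarrow> y \<in> I a \<Longrightarrow> x - y \<in> I a"
  using I_add[OF _ I_uminus] by fastforce

lemma I_sum: "(\<And>i. i \<in> S \<Longrightarrow> f i \<in> I a) \<Longrightarrow> (\<Sum>i\<in>S. f i) \<in> I a"
  by (induction S rule: infinite_finite_induct) (auto intro: I_add)

lemma I_mult:
  assumes "x \<in> I a" and "y \<in> I b"
  shows "x * y \<in> I (a + b)"
proof -
  obtain u v where 1: "coprime v (int p)" "v \<noteq> 0" "x = of_nat p ^ a * of_int u / of_int v"
    using assms(1) by (rule I_E)
  obtain u' v' where 2: "coprime v' (int p)" "v' \<noteq> 0" "y = of_nat p ^ b * of_int u' / of_int v'"
    using assms(2) by (rule I_E)
  show ?thesis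
  proof (rule I_I)
    show "coprime (v * v') (int p)"
      using 1 2 by simp
    show "x * y * of_int (v * v') = of_nat p ^ (a + b) * of_int (u * u')"
      unfolding 1(3) 2(3) using 1(2) 2(2) by (simp add: field_simps power_add)
  qed
qed

lemma I_mult_0: "x \<in> I a \<Longrightarrow> y \<in> I 0 \<Longrightarrow> x * y \<in> I a"
  using I_mult[of x a y 0] by simp

lemma I_0_mult: "x \<in> I 0 \<Longrightarrow> y \<in> I a \<Longrightarrow> x * y \<in> I a"
  using I_mult[of x 0 y a] by simp

lemma p_power_mult_in_I_iff: "of_nat p ^ b * x \<in> I (b + a) \<longleftrightarrow> x \<in> I a"
proof
  have p0: "(of_nat p :: rat) \<noteq> 0"
    using p_gt_2 by simp
  assume "of_nat p ^ b * x \<in> I (b + a)"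
  then obtain u v where "coprime v (int p)" "v \<noteq> 0"
    and "of_nat p ^ b * x = of_nat p ^ (b + a) * of_int u / of_int v"
    by (rule I_E)
  then show "x \<in> I a"
    by (intro I_I[of v _ _ u]) (use p0 in \<open>auto simp: field_simps power_add\<close>)
next
  assume "x \<in> I a"
  then obtain u v where "coprime v (int p)" "v \<noteq> 0" "x = of_nat p ^ a * of_int u / of_int v"
    by (rule I_E)
  then show "of_nat p ^ b * x \<in> I (b + a)"
    by (intro I_I[of v _ _ u]) (auto simp: field_simps power_add)
qed

lemma of_int_in_I_0 [simp]: "of_int z \<in> I 0"
  by (rule I_I[of 1 _ _ z]) auto

lemma of_nat_in_I_0 [simp]: "of_nat z \<in> I 0"
  using of_int_in_I_0[of "int z"] by simp

lemma numeral_in_I_0 [simp]: "numeral z \<in> I 0" "1 \<in> I 0"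
  using of_nat_in_I_0[of "numeral z"] of_nat_in_I_0[of 1] by simp_all

lemma I_power: "x \<in> I 0 \<Longrightarrow> x ^ n \<in> I 0"
  by (induction n) (auto intro: I_0_mult)

lemma of_nat_p_power_in_I: "of_nat p ^ a \<in> I a"
  using p_power_mult_in_I_iff[of a 1 0] by simp

lemma of_nat_in_I:
  assumes "p ^ a dvd n"
  shows "of_nat n \<in> I a"
proof -
  obtain m where "n = p ^ a * m"
    using assms by blast
  then show ?thesis
    using I_mult_0[OF of_nat_p_power_in_I of_nat_in_I_0] by simp
qed

lemma I_antimono:
  assumes "x \<in> I a" and "b \<le> a"
  shows "x \<in> I b"
proof -
  obtain u v where uv: "coprime v (int p)" "v \<noteq> 0" "x = of_nat p ^ a * of_int u / of_int v"
    using assms(1) by (rule I_E)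
  have "of_nat p ^ a = (of_nat p ^ b * of_nat p ^ (a - b) :: rat)"
    using assms(2) by (simp flip: power_add)
  then show ?thesis
    by (intro I_I[of v _ _ "int p ^ (a - b) * u"]) (use uv in auto)
qed

lemma inverse_in_I_0: "coprime m p \<Longrightarrow> 1 / of_nat m \<in> I 0"
  by (rule I_I[of "int m" _ _ 1]) (use coprime_p_nonzero[of "int m"] in auto)

lemma of_nat_cancel_in_I:
  assumes "coprime m p" and "of_nat m * x \<in> I a"
  shows "x \<in> I a"
proof -
  have "x = 1 / of_nat m * (of_nat m * x)"
    using assms(1) coprime_p_nonzero[of "int m"] by auto
  then show ?thesis
    using I_0_mult[OF inverse_in_I_0[OF assms(1)] assms(2)] by simp
qed

lemma two_cancel_in_I: "2 * x \<in> I a \<Longrightarrow> x \<in> I a"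
  using of_nat_cancel_in_I[of 2 x a] odd_p by simp

lemma half_in_I: "x \<in> I a \<Longrightarrow> x / 2 \<in> I a"
  by (rule two_cancel_in_I) simp

text \<open>One power of \<open>p\<close> is given up because 3 is not a unit when \<open>p = 3\<close>.\<close>

lemma three_cancel_in_I:
  assumes "3 * x \<in> I (Suc a)"
  shows "x \<in> I a"
proof (cases "p = 3")
  case True
  then show ?thesis
    using p_power_mult_in_I_iff[of 1 x a] assms by simp
next
  case False
  then have "coprime 3 p"
    using primes_coprime[of 3 p] prime_p by simp
  then show ?thesis
    using of_nat_cancel_in_I[of 3 x "Suc a"] assms I_antimono[of x "Suc a" a] by simp
qed

lemma rat_cong_prime_powerI:
  assumes "x \<in> I 0" and "y \<in> I 0" and "x - y \<in> I a"
  shows "rat_cong_prime_power p a x y"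
proof -
  have *: "coprime (snd (quotient_of z)) (int p) \<and> int p ^ b dvd fst (quotient_of z)"
    if "z \<in> I b" for z b
  proof -
    obtain u v where uv: "coprime v (int p)" "v \<noteq> 0" "z = of_nat p ^ b * of_int u / of_int v"
      using \<open>z \<in> I b\<close> by (rule I_E)
    obtain n d where nd: "quotient_of z = (n, d)"
      by force
    then have d: "d > 0" "coprime n d" "z = of_int n / of_int d"
      using quotient_of_denom_pos quotient_of_coprime quotient_of_div by blast+
    have "(of_int (n * v) :: rat) = of_int (int p ^ b * u * d)"
      using uv d by (simp add: field_simps)
    then have eq: "n * v = int p ^ b * u * d"
      by (simp only: of_int_eq_iff)
    then have "d dvd n * v"
      by simp
    then have "d dvd v"
      using coprime_dvd_mult_right_iff[OF coprime_commute[THEN iffD1, OF d(2)]] by blast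
    then have "coprime d (int p)"
      using uv(1) coprime_divisors[of d v "int p" "int p"] by simp
    have "int p ^ b dvd n * v"
      unfolding eq by (simp add: mult.assoc)
    moreover have "coprime (int p ^ b) v"
      using uv(1) coprime_commute[of v "int p"] by simp
    ultimately have "int p ^ b dvd n"
      using coprime_dvd_mult_left_iff by blast
    then show ?thesis
      using nd \<open>coprime d (int p)\<close> by simp
  qed
  show ?thesis
    unfolding rat_cong_prime_power_def using *[OF assms(1)] *[OF assms(2)] *[OF assms(3)] by blast
qed

end

section \<open>Harmonic sums over triples and over pairs of units\<close>

definition units :: "nat \<Rightarrow> nat set" where
  "units n = {w. 0 < w \<and> w < n \<and> coprime w n}"

lemma finite_units [simp]: "finite (units n)"
  by (rule finite_subset[of _ "{..n}"]) (auto simp: units_def)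

definition Z_index :: "nat \<Rightarrow> (nat \<times> nat \<times> nat) set" where
  "Z_index n = {(i, j, k). i \<in> prime_to n \<and> j \<in> prime_to n \<and> k \<in> prime_to n \<and> i + j + k = n}"

lemma Z_altdef: "Z n = (\<Sum>(i, j, k)\<in>Z_index n. 1 / (of_nat i * of_nat j * of_nat k))"
  by (simp add: Z_def Z_index_def)

lemma sum_Z_index_rotate: "(\<Sum>(i, j, k)\<in>Z_index n. f i j k) = (\<Sum>(i, j, k)\<in>Z_index n. f j k i)"
  by (rule sum.reindex_bij_witness[of _ "\<lambda>(i, j, k). (j, k, i)" "\<lambda>(i, j, k). (k, i, j)"])
     (auto simp: Z_index_def)

lemma sum_Z_index_swap: "(\<Sum>(i, j, k)\<in>Z_index n. f i j k) = (\<Sum>(i, j, k)\<in>Z_index n. f j i k)"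
  by (rule sum.reindex_bij_witness[of _ "\<lambda>(i, j, k). (j, i, k)" "\<lambda>(i, j, k). (j, i, k)"])
     (auto simp: Z_index_def)

definition unit_pairs :: "nat \<Rightarrow> (nat \<times> nat) set" where
  "unit_pairs n = {(i, l). i \<in> units n \<and> l \<in> units n \<and> coprime (int i - int l) (int n)}"

lemma finite_unit_pairs [simp]: "finite (unit_pairs n)"
  by (rule finite_subset[of _ "units n \<times> units n"]) (auto simp: unit_pairs_def)

lemma unit_pairs_sym: "(i, l) \<in> unit_pairs n \<longleftrightarrow> (l, i) \<in> unit_pairs n"
  using coprime_minus_left_iff[of "int i - int l" "int n"] by (auto simp: unit_pairs_def)

text \<open>The sum \<open>X(n)\<close> of the introduction.\<close>

definition unit_pair_sum :: "nat \<Rightarrow> rat" where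
  "unit_pair_sum n = (\<Sum>(i, l)\<in>unit_pairs n. 1 / (of_nat i * of_nat l))"

lemma coprime_diff_iff:
  fixes i l n :: nat
  assumes "i \<le> l"
  shows "coprime (int i - int l) (int n) \<longleftrightarrow> coprime (l - i) n"
proof -
  have "int i - int l = - int (l - i)"
    using assms by simp
  then show ?thesis
    by (metis coprime_int_iff coprime_minus_left_iff)
qed

lemma coprime_complement:
  fixes l n :: nat
  assumes "l \<le> n"
  shows "coprime (n - l) n \<longleftrightarrow> coprime l n"
proof -
  have "gcd (n - l) n = gcd l n"
    using assms
    by (metis gcd.commute gcd_diff1_nat gcd_diff2_nat le_add_diff_inverse2 diff_diff_cancel diff_le_self)
  then show ?thesis
    by (simp add: coprime_iff_gcd_eq_1)
qed

text \<open>
  A triple is determined by the partial sums \<open>i < i + j\<close>, and \<open>i + j = n - k\<close> is a unit because \<open>k\<close> is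
  one.
\<close>

lemma sum_Z_index_partial_sums:
  fixes f :: "nat \<Rightarrow> nat \<Rightarrow> rat"
  shows "(\<Sum>(i, j, k)\<in>Z_index n. f i (i + j)) = (\<Sum>(i, l) | (i, l) \<in> unit_pairs n \<and> i < l. f i l)"
proof (rule sum.reindex_bij_witness[of _ "\<lambda>(i, l). (i, l - i, n - l)" "\<lambda>(i, j, k). (i, i + j)"])
  fix x assume "x \<in> Z_index n"
  then obtain i j k where x: "x = (i, j, k)" "i > 0" "j > 0" "k > 0" "coprime i n" "coprime j n"
      "coprime k n" "n = i + j + k"
    by (auto simp: Z_index_def prime_to_def)
  have "coprime (i + j) n"
    using coprime_complement[of "i + j" n] x by simp
  then show "(case x of (i, j, k) \<Rightarrow> (i, i + j)) \<in> {(i, l). (i, l) \<in> unit_pairs n \<and> i < l}"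
    using x coprime_diff_iff[of i "i + j" n] by (auto simp: unit_pairs_def units_def)
  show "(case (case x of (i, j, k) \<Rightarrow> (i, i + j)) of (i, l) \<Rightarrow> (i, l - i, n - l)) = x"
    using x by simp
  show "(case (case x of (i, j, k) \<Rightarrow> (i, i + j)) of (i, l) \<Rightarrow> f i l) = (case x of (i, j, k) \<Rightarrow> f i (i + j))"
    using x by simp
next
  fix y assume "y \<in> {(i, l). (i, l) \<in> unit_pairs n \<and> i < l}"
  then obtain i l where y: "y = (i, l)" "i > 0" "i < l" "l < n" "coprime i n" "coprime l n"
      "coprime (int i - int l) (int n)"
    by (auto simp: unit_pairs_def units_def)
  then show "(case y of (i, l) \<Rightarrow> (i, l - i, n - l)) \<in> Z_index n"
    using coprime_diff_iff[of i l n] coprime_complement[of l n]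
    by (auto simp: Z_index_def prime_to_def)
  show "(case (case y of (i, l) \<Rightarrow> (i, l - i, n - l)) of (i, j, k) \<Rightarrow> (i, i + j)) = y"
    using y by simp
qed

lemma inverse_mult_eq_sum:
  fixes i j :: nat
  assumes "i > 0" and "j > 0"
  shows "1 / (of_nat i * of_nat j) = (1 / (of_nat i * of_nat (i + j)) + 1 / (of_nat j * of_nat (j + i)) :: rat)"
proof -
  have "(of_nat i :: rat) \<noteq> 0" "(of_nat j :: rat) \<noteq> 0" "(of_nat i + of_nat j :: rat) \<noteq> 0"
    using assms by (simp_all flip: of_nat_add)
  then show ?thesis
    by (simp add: divide_simps) (simp add: algebra_simps)
qed

text \<open>
  Multiplying by \<open>n = i + j + k\<close> removes one of the three denominators. By symmetry this leaves
  three equal sums of \<open>1 / (i j)\<close>, each of which splits into two equal sums over the pairs \<open>i < l\<close>;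
  together these cover both orders of a pair.
\<close>

lemma n_times_Z: "of_nat n * Z n = 3 * unit_pair_sum n"
proof -
  define A where "A = (\<Sum>(i, j, k)\<in>Z_index n. 1 / (of_nat i * of_nat j) :: rat)"
  define B where "B = (\<Sum>(i, l) | (i, l) \<in> unit_pairs n \<and> i < l. 1 / (of_nat i * of_nat l) :: rat)"
  have "of_nat n * Z n = (\<Sum>(i, j, k)\<in>Z_index n. 1 / (of_nat i * of_nat j)
      + 1 / (of_nat j * of_nat k) + 1 / (of_nat k * of_nat i) :: rat)"
    unfolding Z_altdef sum_distrib_left
  proof (intro sum.cong refl, clarify)
    fix i j k assume "(i, j, k) \<in> Z_index n"
    then have n: "n = i + j + k" and "(of_nat i :: rat) \<noteq> 0" "(of_nat j :: rat) \<noteq> 0" "(of_nat k :: rat) \<noteq> 0"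
      by (auto simp: Z_index_def prime_to_def)
    then show "of_nat n * (1 / (of_nat i * of_nat j * of_nat k)) = (1 / (of_nat i * of_nat j)
      + 1 / (of_nat j * of_nat k) + 1 / (of_nat k * of_nat i) :: rat)"
      by (simp add: field_simps)
  qed
  also have "\<dots> = A + (\<Sum>(i, j, k)\<in>Z_index n. 1 / (of_nat j * of_nat k))
      + (\<Sum>(i, j, k)\<in>Z_index n. 1 / (of_nat k * of_nat i))"
    by (simp add: A_def sum.distrib case_prod_unfold)
  also have "(\<Sum>(i, j, k)\<in>Z_index n. 1 / (of_nat j * of_nat k)) = A"
    unfolding A_def by (rule sum_Z_index_rotate[symmetric])
  also have "(\<Sum>(i, j, k)\<in>Z_index n. 1 / (of_nat k * of_nat i)) = A"
    unfolding A_def by (rule sum_Z_index_rotate)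
  finally have Z: "of_nat n * Z n = 3 * A"
    by simp
  have "A = (\<Sum>(i, j, k)\<in>Z_index n. 1 / (of_nat i * of_nat (i + j)) + 1 / (of_nat j * of_nat (j + i)))"
    unfolding A_def
    by (intro sum.cong refl, clarify, rule inverse_mult_eq_sum) (auto simp: Z_index_def prime_to_def)
  also have "\<dots> = (\<Sum>(i, j, k)\<in>Z_index n. 1 / (of_nat i * of_nat (i + j)))
      + (\<Sum>(i, j, k)\<in>Z_index n. 1 / (of_nat j * of_nat (j + i)))"
    by (simp add: sum.distrib case_prod_unfold)
  also have "(\<Sum>(i, j, k)\<in>Z_index n. 1 / (of_nat j * of_nat (j + i)))
      = (\<Sum>(i, j, k)\<in>Z_index n. 1 / (of_nat i * of_nat (i + j) :: rat))"
    by (rule sum_Z_index_swap)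
  also have "\<dots> = B"
    unfolding B_def by (rule sum_Z_index_partial_sums)
  finally have A: "A = B + B" .
  have "B = (\<Sum>(i, l) | (i, l) \<in> unit_pairs n \<and> l < i. 1 / (of_nat i * of_nat l))"
    unfolding B_def
    by (rule sum.reindex_bij_witness[of _ "\<lambda>(i, l). (l, i)" "\<lambda>(i, l). (l, i)"])
      (auto simp: unit_pairs_sym mult.commute)
  then have "B + B = (\<Sum>(i, l)\<in>{(i, l). (i, l) \<in> unit_pairs n \<and> i < l}
      \<union> {(i, l). (i, l) \<in> unit_pairs n \<and> l < i}. 1 / (of_nat i * of_nat l))"
    using B_def by (subst sum.union_disjoint) (auto intro: finite_subset[OF _ finite_unit_pairs[of n]])
  also have "\<dots> = unit_pair_sum n"
    unfolding unit_pair_sum_def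
  proof (rule sum.cong)
    show "{(i, l). (i, l) \<in> unit_pairs n \<and> i < l} \<union> {(i, l). (i, l) \<in> unit_pairs n \<and> l < i} = unit_pairs n"
      by (auto simp: unit_pairs_def units_def intro: ccontr)
  qed simp
  finally show ?thesis
    using A Z by simp
qed

section \<open>Reciprocals along an arithmetic progression\<close>

lemma sum_by_residue:
  fixes F :: "nat \<Rightarrow> rat"
  shows "(\<Sum>i<m * N. F i) = (\<Sum>w<m. \<Sum>t<N. F (w + m * t))"
proof (cases "m = 0")
  case False
  have "w + m * t < m * N" if "w < m" "t < N" for w t
  proof -
    have "w + m * t < m * Suc t"
      using that by simp
    also have "\<dots> \<le> m * N"
      using that by (intro mult_le_mono) auto
    finally show ?thesis .
  qed
  then show ?thesis
    unfolding sum.cartesian_product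
    by (intro sum.reindex_bij_witness[of _ "\<lambda>(w, t). w + m * t" "\<lambda>i. (i mod m, i div m)"])
      (use False in \<open>auto simp: less_mult_imp_div_less mult.commute\<close>)
qed auto

lemma sum_lessThan_of_nat: "(\<Sum>t<N. of_nat t :: rat) = of_nat N * (of_nat N - 1) / 2"
  by (induction N) (auto simp: field_simps)

lemma sum_lessThan_of_nat_squared:
  "3 * (\<Sum>t<N. of_nat t ^ 2 :: rat) = of_nat N * (of_nat N - 1) * (2 * of_nat N - 1) / 2"
  by (induction N) (auto simp: field_simps power2_eq_square)

context odd_prime
begin

lemma coprime_add_multiple:
  fixes w :: nat
  assumes "p dvd y" and "coprime w p"
  shows "coprime (w + y) p"
  using assms prime_imp_coprime[OF prime_p, of "w + y"] not_prime_1 prime_p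
  by (metis coprime_commute coprime_absorb_left dvd_add_left_iff prime_imp_coprime not_prime_unit)

text \<open>Truncations of the geometric series of \<open>1 / (w + y)\<close> in powers of \<open>y / w\<close>.\<close>

lemma inverse_add_cong:
  assumes "coprime w p" and "p ^ Suc b dvd y"
  defines "g \<equiv> 1 / of_nat w :: rat"
  shows "1 / of_nat (w + y) - g \<in> I (Suc b)"
    and "1 / of_nat (w + y) - (g - of_nat y * g ^ 2) \<in> I (2 * Suc b)"
    and "1 / of_nat (w + y) - (g - of_nat y * g ^ 2 + of_nat y ^ 2 * g ^ 3) \<in> I (3 * Suc b)"
proof -
  define h where "h = (1 / of_nat (w + y) :: rat)"
  have c: "coprime (w + y) p"
    using assms(1,2) by (intro coprime_add_multiple) (auto intro: dvd_trans)
  have h: "h \<in> I 0" and g: "g \<in> I 0"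
    unfolding h_def g_def using c assms(1) by (auto intro!: inverse_in_I_0 simp del: of_nat_add)
  have gk: "g ^ k \<in> I 0" for k
    using g by (rule I_power)
  have y: "of_nat y \<in> I (Suc b)"
    using assms(2) by (rule of_nat_in_I)
  have nz: "(of_nat w :: rat) \<noteq> 0" "(of_nat w + of_nat y :: rat) \<noteq> 0"
    using assms(1) c p_gt_2 by (auto simp flip: of_nat_add intro!: Nat.gr0I)
  have y2: "of_nat y ^ 2 \<in> I (2 * Suc b)"
    using I_mult[OF y y] by (simp add: power2_eq_square mult_2)
  have y3: "of_nat y ^ 3 \<in> I (3 * Suc b)"
  proof -
    have "of_nat y ^ 3 = (of_nat y * of_nat y ^ 2 :: rat)" and "3 * Suc b = Suc b + 2 * Suc b"
      by (simp_all add: power3_eq_cube power2_eq_square)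
    then show ?thesis
      using I_mult[OF y y2] by metis
  qed
  have e: "h - g = - (of_nat y * (g * h))"
    unfolding h_def g_def using nz by (simp add: field_simps)
  then show "1 / of_nat (w + y) - g \<in> I (Suc b)"
    using y g h unfolding h_def[symmetric] by (auto intro!: I_uminus I_mult_0[of _ "Suc b"] intro: I_0_mult)
  have "h - (g - of_nat y * g ^ 2) = (h - g) + of_nat y * g ^ 2"
    by simp
  also have "\<dots> = - (of_nat y * g * (h - g))"
    using arg_cong[OF e, of "\<lambda>x. x + of_nat y * g ^ 2"] by (simp add: algebra_simps power2_eq_square)
  finally have e2: "h - (g - of_nat y * g ^ 2) = of_nat y ^ 2 * (g ^ 2 * h)"
    unfolding e by (simp add: power2_eq_square)
  then show "1 / of_nat (w + y) - (g - of_nat y * g ^ 2) \<in> I (2 * Suc b)"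
    using y2 h gk unfolding h_def[symmetric]
    by (metis I_mult_0)
  have "h - (g - of_nat y * g ^ 2 + of_nat y ^ 2 * g ^ 3)
      = (h - (g - of_nat y * g ^ 2)) - of_nat y ^ 2 * g ^ 3"
    by simp
  also have "\<dots> = of_nat y ^ 2 * g ^ 2 * (h - g)"
    unfolding e2 by (simp add: algebra_simps power2_eq_square power3_eq_cube)
  finally have "h - (g - of_nat y * g ^ 2 + of_nat y ^ 2 * g ^ 3) = - (of_nat y ^ 3 * (g ^ 3 * h))"
    unfolding e by (simp add: power2_eq_square power3_eq_cube)
  then show "1 / of_nat (w + y) - (g - of_nat y * g ^ 2 + of_nat y ^ 2 * g ^ 3) \<in> I (3 * Suc b)"
    using y3 h gk unfolding h_def[symmetric] by (metis I_mult_0 I_uminus)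
qed

text \<open>
  The geometric series in \<open>Q t / w\<close> cannot simply be truncated after the linear term, since the
  sum is wanted modulo \<open>p\<^bsup>a+2\<^esup>\<close> whereas a single quadratic term is only divisible by \<open>p\<^sup>2\<close>. Induction
  on \<open>a\<close> avoids the higher power sums: for \<open>N = p M\<close> the progression is cut into \<open>p\<close> translates by
  multiples of \<open>Q M\<close>, a number so divisible that expanding to second order suffices. The factor 3
  clears the denominator of the sum of squares over \<open>s < p\<close>.
\<close>

lemma sum_inverse_progression:
  assumes "p dvd Q" and "coprime w p" and "p ^ a dvd N"
  shows "3 * (\<Sum>t<N. 1 / of_nat (w + Q * t))
    - 3 * (of_nat N / of_nat w - of_nat Q * of_nat N * (of_nat N - 1) / 2 / of_nat w ^ 2) \<in> I (a + 2)"
  using assms(3)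
proof (induction a arbitrary: N)
  case 0
  have "1 / of_nat (w + Q * t) - (1 / of_nat w - of_nat (Q * t) * (1 / of_nat w) ^ 2) \<in> I 2" for t
    using inverse_add_cong(2)[of w 0 "Q * t"] assms by (auto simp: numeral_2_eq_2)
  then have "3 * (\<Sum>t<N. 1 / of_nat (w + Q * t) - (1 / of_nat w - of_nat (Q * t) * (1 / of_nat w) ^ 2)) \<in> I 2"
    by (intro I_0_mult I_sum) auto
  also have "(\<Sum>t<N. 1 / of_nat (w + Q * t) - (1 / of_nat w - of_nat (Q * t) * (1 / of_nat w) ^ 2))
      = (\<Sum>t<N. 1 / of_nat (w + Q * t))
        - (of_nat N / of_nat w - of_nat Q * (\<Sum>t<N. of_nat t) / of_nat w ^ 2 :: rat)"
    by (simp add: sum_subtractf sum_distrib_left sum_divide_distrib power_one_over)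
  finally show ?case
    by (simp add: sum_lessThan_of_nat mult.assoc flip: numeral_2_eq_2)
next
  case (Suc a)
  obtain M where N: "N = M * p"
    using Suc.prems by (metis dvd_mult_left dvdE mult.commute power_Suc)
  have M: "p ^ a dvd M"
    using Suc.prems p_gt_2 unfolding N by (simp add: mult.commute[of M])
  define P where "P = (of_nat p :: rat)"
  define R where "R = (of_nat M :: rat)"
  define q where "q = (of_nat Q :: rat)"
  define v where "v = (1 / of_nat w :: rat)"
  define g where "g t = (1 / of_nat (w + Q * t) :: rat)" for t
  \<comment> \<open>\<open>D t\<close> is the error of the first-order expansion of the translates of the \<open>t\<close>-th term.\<close>
  define D where "D t = 3 * (\<Sum>s<p. 1 / of_nat (w + Q * t + Q * M * s))
    - 3 * (P * g t - q * R * (P * (P - 1) / 2) * g t ^ 2)" for t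
  define c where "c = q * R * (P * (P - 1) / 2)"
  have cop: "coprime (w + Q * t) p" for t
    using assms by (intro coprime_add_multiple) auto
  have QM: "p ^ Suc a dvd Q * M"
    using assms(1) M by (simp add: mult_dvd_mono)
  have P: "P \<in> I 1" and P0: "P \<in> I 0"
    using of_nat_p_power_in_I[of 1] by (simp_all add: P_def)
  have qR: "q * R \<in> I (Suc a)"
    using of_nat_in_I[OF QM] by (simp add: q_def R_def)
  have g0: "g t \<in> I 0" for t
    unfolding g_def by (rule inverse_in_I_0[OF cop])
  have D: "D t \<in> I (Suc a + 2)" for t
  proof -
    define E where "E s = 1 / of_nat (w + Q * t + Q * M * s)
      - (g t - of_nat (Q * M * s) * g t ^ 2 + of_nat (Q * M * s) ^ 2 * g t ^ 3)" for s
    have "E s \<in> I (3 * Suc a)" for s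
      unfolding E_def g_def using cop QM by (intro inverse_add_cong(3)) (auto intro: dvd_mult2)
    then have "3 * (\<Sum>s<p. E s) \<in> I (3 * Suc a)"
      by (intro I_0_mult I_sum) auto
    then have 1: "3 * (\<Sum>s<p. E s) \<in> I (Suc a + 2)"
      by (rule I_antimono) simp
    have "(q * R) * (q * R) * (P * (((P - 1) * (2 * P - 1) / 2) * g t ^ 3)) \<in> I (Suc a + Suc a + (1 + 0))"
      using P0 g0 by (intro I_mult qR P I_mult_0 half_in_I I_diff I_power) (auto intro!: I_0_mult)
    then have 2: "(q * R) * (q * R) * (P * (((P - 1) * (2 * P - 1) / 2) * g t ^ 3)) \<in> I (Suc a + 2)"
      by (rule I_antimono) simp
    have "(\<Sum>s<p. E s) = (\<Sum>s<p. 1 / of_nat (w + Q * t + Q * M * s))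
        - (P * g t - q * R * (\<Sum>s<p. of_nat s) * g t ^ 2 + (q * R) ^ 2 * (\<Sum>s<p. of_nat s ^ 2) * g t ^ 3)"
      by (simp add: E_def P_def q_def R_def sum_subtractf sum.distrib sum_distrib_left
          sum_distrib_right power_mult_distrib mult.assoc)
    then have "D t = 3 * (\<Sum>s<p. E s) + (q * R) ^ 2 * (3 * (\<Sum>s<p. of_nat s ^ 2)) * g t ^ 3"
      by (simp add: D_def sum_lessThan_of_nat flip: P_def)
    then have "D t = 3 * (\<Sum>s<p. E s) + (q * R) * (q * R) * (P * (((P - 1) * (2 * P - 1) / 2) * g t ^ 3))"
      unfolding sum_lessThan_of_nat_squared by (simp add: P_def power2_eq_square)
    then show ?thesis
      using I_add[OF 1 2] by simp
  qed
  \<comment> \<open>The quadratic coefficient comes with a factor in \<open>I (Suc a + 1)\<close>, so it is needed modulo \<open>p\<close> only.\<close>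
  have "g t ^ 2 - v ^ 2 \<in> I 1" for t
  proof -
    have "g t - v \<in> I 1"
      using inverse_add_cong(1)[of w 0 "Q * t"] assms by (simp add: g_def v_def)
    moreover have "v \<in> I 0"
      unfolding v_def by (rule inverse_in_I_0[OF assms(2)])
    ultimately have "(g t - v) * (g t + v) \<in> I 1"
      using g0[of t] by (intro I_mult_0 I_add) auto
    then show ?thesis
      by (simp add: power2_eq_square algebra_simps)
  qed
  then have "(\<Sum>t<M. g t ^ 2 - v ^ 2) \<in> I 1"
    by (intro I_sum) auto
  then have S: "(\<Sum>t<M. g t ^ 2) - R * v ^ 2 \<in> I 1"
    by (simp add: sum_subtractf R_def)
  have "3 * ((q * R) * (P * ((P - 1) / 2 * ((\<Sum>t<M. g t ^ 2) - R * v ^ 2)))) \<in> I (Suc a + (1 + (0 + 1)))"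
    using P0 by (intro I_0_mult[of 3] I_mult qR P S half_in_I I_diff) auto
  then have 3: "3 * ((q * R) * (P * ((P - 1) / 2 * ((\<Sum>t<M. g t ^ 2) - R * v ^ 2)))) \<in> I (Suc a + 2)"
    by simp
  have 2: "P * (3 * (\<Sum>t<M. g t) - 3 * (R * v - q * R * (R - 1) / 2 * v ^ 2)) \<in> I (Suc a + 2)"
    using I_mult[OF P Suc.IH[OF M]] by (simp add: g_def R_def q_def v_def power_one_over)
  have "3 * (\<Sum>t<N. 1 / of_nat (w + Q * t)) = (\<Sum>t<M. 3 * (\<Sum>s<p. 1 / of_nat (w + Q * t + Q * M * s)) :: rat)"
    unfolding N sum_by_residue sum_distrib_left by (simp add: algebra_simps)
  also have "\<dots> = (\<Sum>t<M. D t + (3 * P * g t - 3 * c * g t ^ 2))"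
    unfolding D_def c_def by (intro sum.cong refl) (simp add: field_simps)
  also have "\<dots> = (\<Sum>t<M. D t) + 3 * P * (\<Sum>t<M. g t) - 3 * c * (\<Sum>t<M. g t ^ 2)"
    by (simp add: sum.distrib sum_subtractf sum_distrib_left)
  finally have sum: "3 * (\<Sum>t<N. 1 / of_nat (w + Q * t))
    = (\<Sum>t<M. D t) + 3 * P * (\<Sum>t<M. g t) - 3 * c * (\<Sum>t<M. g t ^ 2)" .
  have main: "of_nat N / of_nat w - of_nat Q * of_nat N * (of_nat N - 1) / 2 / of_nat w ^ 2
    = R * P * v - q * (R * P) * (R * P - 1) / 2 * v ^ 2"
    by (simp add: N P_def R_def q_def v_def power_one_over)
  have "x + 3 * P * y - 3 * c * z - 3 * (R * P * v - q * (R * P) * (R * P - 1) / 2 * v ^ 2)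
    = x + P * (3 * y - 3 * (R * v - q * R * (R - 1) / 2 * v ^ 2))
      - 3 * ((q * R) * (P * ((P - 1) / 2 * (z - R * v ^ 2))))" for x y z
    by (simp add: c_def field_simps)
  then have "3 * (\<Sum>t<N. 1 / of_nat (w + Q * t))
    - 3 * (of_nat N / of_nat w - of_nat Q * of_nat N * (of_nat N - 1) / 2 / of_nat w ^ 2)
    = (\<Sum>t<M. D t) + P * (3 * (\<Sum>t<M. g t) - 3 * (R * v - q * R * (R - 1) / 2 * v ^ 2))
      - 3 * ((q * R) * (P * ((P - 1) / 2 * ((\<Sum>t<M. g t ^ 2) - R * v ^ 2))))"
    unfolding sum main .
  then show ?case
    using I_diff[OF I_add[OF I_sum[of "{..<M}" D, OF D] 2] 3] by simp
qed

end

section \<open>Removing repeated prime factors\<close>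

text \<open>If all prime factors of \<open>N\<close> divide \<open>m\<close>, then \<open>m N\<close> and \<open>m\<close> have the same units.\<close>

lemma coprime_mult_power_divisor:
  fixes x m N :: "'a :: semiring_gcd"
  assumes "N dvd m ^ k"
  shows "coprime x (m * N) \<longleftrightarrow> coprime x m"
proof
  assume "coprime x m"
  then have "coprime x (m ^ k)"
    by simp
  then have "coprime x N"
    using assms coprime_divisors dvd_refl by blast
  then show "coprime x (m * N)"
    using \<open>coprime x m\<close> by simp
qed simp

lemma coprime_add_mult_iff:
  fixes w m t :: nat
  shows "coprime (w + m * t) m \<longleftrightarrow> coprime w m"
  using gcd_add_mult[of m t w] by (simp add: coprime_iff_gcd_eq_1 gcd.commute[of _ m] ac_simps)

lemma units_altdef: "m > 1 \<Longrightarrow> units m = {w \<in> {..<m}. coprime w m}"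
  by (auto simp: units_def intro!: Nat.gr0I)

lemma sum_units_by_residue:
  fixes F :: "nat \<Rightarrow> rat"
  assumes "m > 1" and "N > 0" and "N dvd m ^ k"
  shows "(\<Sum>i\<in>units (m * N). F i) = (\<Sum>w\<in>units m. \<Sum>t<N. F (w + m * t))"
proof -
  have "m * N > 1"
    using assms by (metis less_1_mult mult.right_neutral nat_neq_iff less_one not_less0)
  then have "(\<Sum>i\<in>units (m * N). F i) = (\<Sum>i<m * N. if coprime i m then F i else 0)"
    by (simp only: units_altdef coprime_mult_power_divisor[OF assms(3)] sum.inter_filter finite_lessThan)
  also have "\<dots> = (\<Sum>w<m. \<Sum>t<N. if coprime w m then F (w + m * t) else 0)"
    unfolding sum_by_residue
    by (intro sum.cong refl) (simp add: coprime_add_mult_iff)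
  also have "\<dots> = (\<Sum>w<m. if coprime w m then \<Sum>t<N. F (w + m * t) else 0)"
    by (intro sum.cong refl) simp
  also have "\<dots> = (\<Sum>w\<in>units m. \<Sum>t<N. F (w + m * t))"
    using assms(1) by (simp only: units_altdef sum.inter_filter finite_lessThan)
  finally show ?thesis .
qed

lemma sum_unit_pairs:
  fixes f :: "nat \<Rightarrow> nat \<Rightarrow> rat"
  shows "(\<Sum>(i, l)\<in>unit_pairs n. f i l)
    = (\<Sum>i\<in>units n. \<Sum>l\<in>units n. if coprime (int i - int l) (int n) then f i l else 0)"
proof -
  have "unit_pairs n = {x \<in> units n \<times> units n. coprime (int (fst x) - int (snd x)) (int n)}"
    by (auto simp: unit_pairs_def)
  then have "(\<Sum>(i, l)\<in>unit_pairs n. f i l) = (\<Sum>x\<in>units n \<times> units n.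
      if coprime (int (fst x) - int (snd x)) (int n) then f (fst x) (snd x) else 0)"
    by (simp add: case_prod_unfold sum.inter_filter)
  then show ?thesis
    by (simp add: sum.cartesian_product case_prod_unfold)
qed

lemma unit_pair_sum_by_residue:
  assumes "m > 1" and "N > 0" and "N dvd m ^ k"
  defines "K \<equiv> \<lambda>w. \<Sum>t<N. 1 / of_nat (w + m * t) :: rat"
  shows "unit_pair_sum (m * N) = (\<Sum>(w, w')\<in>unit_pairs m. K w * K w')"
proof -
  have N: "int N dvd int m ^ k"
    using assms(3) by (metis of_nat_dvd_iff of_nat_power)
  have cop: "coprime (int (w + m * t) - int (w' + m * t')) (int (m * N)) \<longleftrightarrow> coprime (int w - int w') (int m)"
    for w w' t t'
  proof -
    have eq: "int (w + m * t) - int (w' + m * t') = (int t - int t') * int m + (int w - int w')"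
      by (simp add: algebra_simps)
    have "coprime (int (w + m * t) - int (w' + m * t')) (int (m * N))
        \<longleftrightarrow> coprime (int (w + m * t) - int (w' + m * t')) (int m)"
      unfolding of_nat_mult using N by (rule coprime_mult_power_divisor)
    also have "\<dots> \<longleftrightarrow> coprime (int w - int w') (int m)"
      unfolding eq coprime_iff_gcd_eq_1 gcd.commute[of _ "int m"] gcd_add_mult ..
    finally show ?thesis .
  qed
  have "unit_pair_sum (m * N) = (\<Sum>w\<in>units m. \<Sum>t<N. \<Sum>w'\<in>units m. \<Sum>t'<N.
      if coprime (int w - int w') (int m) then 1 / (of_nat (w + m * t) * of_nat (w' + m * t')) else 0)"
    unfolding unit_pair_sum_def sum_unit_pairs sum_units_by_residue[OF assms(1-3)] cop ..
  also have "\<dots> = (\<Sum>w\<in>units m. \<Sum>w'\<in>units m. \<Sum>t<N. \<Sum>t'<N.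
      if coprime (int w - int w') (int m) then 1 / (of_nat (w + m * t) * of_nat (w' + m * t')) else 0)"
    by (intro sum.cong refl sum.swap)
  also have "\<dots> = (\<Sum>w\<in>units m. \<Sum>w'\<in>units m. if coprime (int w - int w') (int m) then K w * K w' else 0)"
    by (intro sum.cong refl) (simp add: K_def sum_product del: of_nat_add of_nat_mult)
  finally show ?thesis
    by (simp add: sum_unit_pairs)
qed

context odd_prime
begin

text \<open>Pairing \<open>x\<close> with \<open>\<sigma> x\<close> counts every term twice, which is harmless as 2 is invertible modulo \<open>p\<close>.\<close>

lemma sum_in_I_by_involution:
  assumes "\<And>x. x \<in> S \<Longrightarrow> \<sigma> x \<in> S" and "\<And>x. x \<in> S \<Longrightarrow> \<sigma> (\<sigma> x) = x"
    and "\<And>x. x \<in> S \<Longrightarrow> F x + F (\<sigma> x) \<in> I a"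
  shows "sum F S \<in> I a"
proof -
  have "sum F S = (\<Sum>x\<in>S. F (\<sigma> x))"
    using assms(1,2) by (intro sum.reindex_bij_witness[of _ \<sigma> \<sigma>]) auto
  then have "2 * sum F S = (\<Sum>x\<in>S. F x + F (\<sigma> x))"
    by (simp add: sum.distrib)
  also have "\<dots> \<in> I a"
    using assms(3) by (rule I_sum)
  finally show ?thesis
    by (rule two_cancel_in_I)
qed

lemma coprime_p_units:
  assumes "p dvd m" and "w \<in> units m"
  shows "coprime w p"
  using assms coprime_divisors[of w w p m] by (auto simp: units_def)

lemma inverse_units_reflect:
  assumes "p dvd m" and "w \<in> units m"
  shows "m - w \<in> units m" and "1 / of_nat w + 1 / of_nat (m - w) \<in> I 1"
proof -
  show 1: "m - w \<in> units m"
    using assms(2) coprime_complement[of w m] by (auto simp: units_def)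
  have "1 / of_nat w + 1 / of_nat (m - w) = (of_nat m * (1 / of_nat w * (1 / of_nat (m - w))) :: rat)"
    using assms(2) by (simp add: units_def of_nat_diff field_simps)
  also have "\<dots> \<in> I 1"
    using assms coprime_p_units[OF assms(1)] 1
    by (intro I_mult_0[where a = 1] I_0_mult[where a = 0] inverse_in_I_0 of_nat_in_I) auto
  finally show "1 / of_nat w + 1 / of_nat (m - w) \<in> I 1" .
qed

text \<open>
  The summand has odd degree, so it changes sign modulo \<open>p\<close> when both units are replaced by their
  negatives.
\<close>

lemma sum_unit_pairs_cubic:
  assumes "p dvd m"
  shows "(\<Sum>(w, w')\<in>unit_pairs m. 1 / of_nat w * (1 / of_nat w') * (1 / of_nat w + 1 / of_nat w')) \<in> I 1"
proof (rule sum_in_I_by_involution[of _ "\<lambda>(w, w'). (m - w, m - w')"], goal_cases)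
  case (1 x)
  obtain w w' where x0: "x = (w, w')"
    by force
  then have "(w', w) \<in> unit_pairs m"
    using 1 unit_pairs_sym by simp
  then have x: "x = (w, w')" "w \<in> units m" "w' \<in> units m" "coprime (int w' - int w) (int m)"
    using x0 by (auto simp: unit_pairs_def)
  moreover have "int (m - w) - int (m - w') = int w' - int w"
    using x(2,3) by (simp add: units_def)
  ultimately show ?case
    using inverse_units_reflect(1)[OF assms] by (simp add: unit_pairs_def)
next
  case (2 x)
  then show ?case
    by (auto simp: unit_pairs_def units_def)
next
  case (3 x)
  obtain w w' where x: "x = (w, w')"
    by force
  with 3 have w: "w \<in> units m" "w' \<in> units m"
    by (auto simp: unit_pairs_def)
  define v where "v = (1 / of_nat w :: rat)"
  define v' where "v' = (1 / of_nat w' :: rat)"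
  define u where "u = (1 / of_nat (m - w) :: rat)"
  define u' where "u' = (1 / of_nat (m - w') :: rat)"
  have vu: "v + u \<in> I 1" "v' + u' \<in> I 1"
    unfolding v_def u_def v'_def u'_def by (rule inverse_units_reflect[OF assms w(1)] inverse_units_reflect[OF assms w(2)])+
  have 0: "v \<in> I 0" "v' \<in> I 0" "u \<in> I 0" "u' \<in> I 0"
    unfolding v_def u_def v'_def u'_def using w inverse_units_reflect(1)[OF assms]
    by (auto intro!: inverse_in_I_0 coprime_p_units[OF assms])
  have "v * v' * (v + v') + u * u' * (u + u')
      = u * u' * ((v + u) + (v' + u')) + ((v + u) * - u' + v * (v' + u')) * (v + v')"
    by (simp add: algebra_simps)
  also have "\<dots> \<in> I 1"
    by (intro I_add[of _ 1] I_0_mult[where a = 1] I_mult_0[where a = 1] I_add[of _ 0] I_uminus[of _ 0]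
        I_0_mult[where a = 0] vu 0)
  finally show ?case
    by (simp add: x v_def v'_def u_def u'_def)
qed

text \<open>
  The sums \<open>K w\<close> of \<open>1 / (w + m t)\<close> are replaced by their first-order approximations \<open>y w\<close>. Since \<open>K w\<close>
  and \<open>y w\<close> are divisible by \<open>p\<^sup>a\<close>, an error modulo \<open>p\<^bsup>a+2\<^esup>\<close> in one factor is an error modulo \<open>p\<^bsup>2a+2\<^esup>\<close> in
  the product. The denominator \<open>m N\<close> of \<open>Z(m N)\<close> costs \<open>a + 1\<close> of these powers of \<open>p\<close>.
\<close>

lemma Z_mult_cong:
  fixes a c k m M N :: nat
  assumes "c > 0" and "M > 0" and "coprime c p" and "coprime M p"
  defines "m \<equiv> p * c" and "N \<equiv> p ^ a * M"
  assumes "N dvd m ^ k"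
  shows "Z (m * N) - of_nat N * Z m \<in> I (Suc a)"
proof -
  have pm: "p dvd m" and m1: "m > 1" and N0: "N > 0" and pN: "p ^ a dvd N"
    using p_gt_2 assms(1,2) order.strict_trans2[of 1 p "p * c"] by (auto simp: m_def N_def)
  define K where "K w = (\<Sum>t<N. 1 / of_nat (w + m * t) :: rat)" for w
  define R where "R = (of_nat N :: rat)"
  \<comment> \<open>The first-order coefficient, which is the same for all \<open>w\<close>.\<close>
  define E where "E = of_nat m * (R - 1) / 2"
  define v where "v w = (1 / of_nat w :: rat)" for w
  define y where "y w = R * (v w - E * v w ^ 2)" for w
  have R: "R \<in> I a" and R0: "R \<in> I 0"
    unfolding R_def using pN by (simp_all add: of_nat_in_I)
  have E: "E \<in> I 1"
    unfolding E_def using R0 pm by (intro half_in_I I_mult_0[where a = 1] of_nat_in_I I_diff) auto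
  then have E0: "E \<in> I 0"
    by (rule I_antimono) simp
  have v0: "v w \<in> I 0" if "w \<in> units m" for w
    unfolding v_def using coprime_p_units[OF pm that] by (rule inverse_in_I_0)
  have y: "y w \<in> I a" if "w \<in> units m" for w
    unfolding y_def using that R E0 v0 by (intro I_mult_0[where a = a] I_diff I_0_mult[where a = 0] I_power)
  have d3: "3 * (K w - y w) \<in> I (a + 2)" if "w \<in> units m" for w
    using sum_inverse_progression[OF pm coprime_p_units[OF pm that] pN]
    by (simp add: K_def y_def R_def E_def v_def power_one_over algebra_simps)
  have K: "K w \<in> I a" if "w \<in> units m" for w
  proof -
    have "K w - y w \<in> I (Suc a)"
      using d3[OF that] three_cancel_in_I[of "K w - y w" "Suc a"] by (simp only: add_2_eq_Suc')
    then have "K w - y w \<in> I a"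
      by (rule I_antimono) simp
    then show ?thesis
      using I_add[of "K w - y w" a "y w"] y[OF that] by simp
  qed
  have pair: "3 * (K w * K w' - y w * y w') \<in> I (2 * a + 2)"
    if "(w, w') \<in> unit_pairs m" for w w'
  proof -
    have w: "w \<in> units m" "w' \<in> units m"
      using that by (auto simp: unit_pairs_def)
    have "(3 * (K w - y w)) * K w' + (3 * (K w' - y w')) * y w \<in> I (a + 2 + a)"
      using w by (intro I_add I_mult d3 K y)
    then show ?thesis
      by (simp add: algebra_simps mult_2_right)
  qed
  have "(\<Sum>(w, w')\<in>unit_pairs m. 3 * (K w * K w' - y w * y w')) \<in> I (2 * a + 2)"
    using pair by (intro I_sum) auto
  also have "(\<Sum>(w, w')\<in>unit_pairs m. 3 * (K w * K w' - y w * y w'))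
      = 3 * (\<Sum>(w, w')\<in>unit_pairs m. K w * K w') - 3 * (\<Sum>(w, w')\<in>unit_pairs m. y w * y w')"
    by (simp add: case_prod_unfold sum_distrib_left sum_subtractf right_diff_distrib)
  also have "(\<Sum>(w, w')\<in>unit_pairs m. K w * K w') = unit_pair_sum (m * N)"
    unfolding K_def by (rule unit_pair_sum_by_residue[OF m1 N0 assms(7), symmetric])
  finally have 1: "3 * unit_pair_sum (m * N) - 3 * (\<Sum>(w, w')\<in>unit_pairs m. y w * y w') \<in> I (2 * a + 2)" .
  define C where "C = (\<Sum>(w, w')\<in>unit_pairs m. v w * v w' * (v w + v w'))"
  define S where "S = (\<Sum>(w, w')\<in>unit_pairs m. (v w * v w') ^ 2)"
  have C: "C \<in> I 1"
    unfolding C_def v_def by (rule sum_unit_pairs_cubic[OF pm])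
  have S: "S \<in> I 0"
    unfolding S_def using v0 by (intro I_sum) (auto simp: unit_pairs_def intro!: I_power I_0_mult[where a = 0])
  have "(\<Sum>(w, w')\<in>unit_pairs m. y w * y w')
      = (\<Sum>(w, w')\<in>unit_pairs m. R * R * (v w * v w') - R * R * E * (v w * v w' * (v w + v w'))
          + R * R * E * E * (v w * v w') ^ 2)"
    by (intro sum.cong refl) (auto simp: y_def algebra_simps power2_eq_square)
  also have "\<dots> = R * R * unit_pair_sum m - R * R * E * C + R * R * E * E * S"
    by (simp add: C_def S_def unit_pair_sum_def v_def case_prod_unfold sum.distrib sum_subtractf
        sum_distrib_left)
  finally have y_sum: "(\<Sum>(w, w')\<in>unit_pairs m. y w * y w')
      = R * R * unit_pair_sum m - R * R * E * C + R * R * E * E * S" .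
  have "3 * (R * R * (E * E * S - E * C)) \<in> I ((a + a) + (1 + 1))"
    using R E C S by (intro I_0_mult[of 3] I_mult I_diff I_mult_0[of "E * E"]) auto
  then have 2: "3 * (R * R * (E * E * S - E * C)) \<in> I (2 * a + 2)"
    by (simp add: mult_2)
  have "3 * unit_pair_sum (m * N) - R * R * (3 * unit_pair_sum m) \<in> I (2 * a + 2)"
    using I_add[OF 1 2] unfolding y_sum by (simp add: algebra_simps)
  also have "3 * unit_pair_sum (m * N) - R * R * (3 * unit_pair_sum m)
      = of_nat p ^ Suc a * (of_nat (c * M) * (Z (m * N) - R * Z m))"
    by (simp add: n_times_Z[symmetric] R_def m_def N_def algebra_simps)
  finally have "of_nat p ^ Suc a * (of_nat (c * M) * (Z (m * N) - R * Z m)) \<in> I (Suc a + Suc a)"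
    by (simp add: mult_2)
  then have "of_nat (c * M) * (Z (m * N) - R * Z m) \<in> I (Suc a)"
    unfolding p_power_mult_in_I_iff .
  moreover have "coprime (c * M) p"
    using assms(3,4) by simp
  ultimately show ?thesis
    using of_nat_cancel_in_I unfolding R_def by blast
qed

end

section \<open>The sum of inverse squares and Bernoulli numbers\<close>

lemma sum_triangle_swap:
  fixes f :: "nat \<Rightarrow> nat \<Rightarrow> rat"
  shows "(\<Sum>k\<le>m. \<Sum>j\<le>m - k. f k j) = (\<Sum>j\<le>m. \<Sum>k\<le>m - j. f k j)"
  unfolding sum.Sigma[OF finite_atMost ballI[OF finite_atMost]]
  by (rule sum.reindex_bij_witness[of _ prod.swap prod.swap]) auto

text \<open>
  After expanding by the binomial theorem, the coefficient of \<open>x\<^sup>j\<close> is the sum in the Bernoulli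
  recursion for \<open>m - j\<close>, which vanishes unless \<open>j = m\<close>.
\<close>

lemma bernoulli_sum_step:
  fixes x :: rat
  shows "(\<Sum>k\<le>m. of_nat (Suc m choose k) * bernoulli k * ((x + 1) ^ (Suc m - k) - x ^ (Suc m - k)))
    = of_nat (Suc m) * x ^ m"
proof -
  have binom: "(x + 1) ^ (Suc m - k) - x ^ (Suc m - k) = (\<Sum>j\<le>m - k. of_nat (Suc m - k choose j) * x ^ j)"
    if "k \<le> m" for k
    using that binomial_ring[of x 1 "Suc m - k"] by (simp add: Suc_diff_le)
  have choose: "(Suc m choose k) * (Suc m - k choose j) = (Suc m choose j) * (Suc m - j choose k)"
    if "k + j \<le> m" for k j
    using that choose_mult[of k "k + j" "Suc m"] choose_mult[of j "k + j" "Suc m"]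
      binomial_symmetric[of k "k + j"] by simp
  have "(\<Sum>k\<le>m. of_nat (Suc m choose k) * bernoulli k * ((x + 1) ^ (Suc m - k) - x ^ (Suc m - k)))
      = (\<Sum>k\<le>m. \<Sum>j\<le>m - k. of_nat ((Suc m choose k) * (Suc m - k choose j)) * bernoulli k * x ^ j)"
    by (intro sum.cong refl) (simp add: binom sum_distrib_left mult_ac)
  also have "\<dots> = (\<Sum>j\<le>m. \<Sum>k\<le>m - j. of_nat ((Suc m choose k) * (Suc m - k choose j)) * bernoulli k * x ^ j)"
    by (rule sum_triangle_swap)
  also have "\<dots> = (\<Sum>j\<le>m. of_nat (Suc m choose j) * x ^ j
      * (\<Sum>k\<le>m - j. of_nat (Suc (m - j) choose k) * bernoulli k))"
    unfolding sum_distrib_left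
  proof (intro sum.cong refl)
    fix j k assume "j \<in> {..m}" "k \<in> {..m - j}"
    then have "k + j \<le> m" and "Suc m - j = Suc (m - j)"
      by auto
    then show "of_nat ((Suc m choose k) * (Suc m - k choose j)) * bernoulli k * x ^ j
        = of_nat (Suc m choose j) * x ^ j * (of_nat (Suc (m - j) choose k) * bernoulli k)"
      by (simp only: choose of_nat_mult mult_ac)
  qed
  also have "\<dots> = (\<Sum>j\<le>m. if j = m then of_nat (Suc m) * x ^ m else 0)"
    by (intro sum.cong refl) (use bernoulli_recursion in \<open>auto simp del: binomial_Suc_Suc\<close>)
  also have "\<dots> = of_nat (Suc m) * x ^ m"
    by simp
  finally show ?thesis .
qed

text \<open>Faulhaber's formula.\<close>

lemma sum_of_powers_bernoulli:
  "of_nat (Suc m) * (\<Sum>x<l. of_nat x ^ m)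
    = (\<Sum>k\<le>m. of_nat (Suc m choose k) * bernoulli k * of_nat l ^ (Suc m - k))"
proof (induction l)
  case 0
  then show ?case
    by (auto intro!: sum.neutral[symmetric] simp: Suc_diff_le)
next
  case (Suc l)
  then show ?case
    using bernoulli_sum_step[of m "of_nat l"]
    by (simp add: distrib_left right_diff_distrib sum_subtractf add.commute)
qed

context odd_prime
begin

lemma coprime_less_p: "0 < k \<Longrightarrow> k < p \<Longrightarrow> coprime k p"
  using prime_p by (meson coprime_commute nat_dvd_not_less prime_imp_coprime)

lemma units_p: "units p = {1..<p}"
  by (auto simp: units_def coprime_less_p Suc_le_eq)

text \<open>The recursion for \<open>B\<^bsub>k\<^esub>\<close> only divides by numbers up to \<open>k + 1 < p\<close>.\<close>

lemma bernoulli_in_I_0: "k < p - 1 \<Longrightarrow> bernoulli k \<in> I 0"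
proof (induction k rule: less_induct)
  case (less k)
  show ?case
  proof (cases k)
    case (Suc n)
    have "coprime (n + 2) p"
      using less.prems Suc by (intro coprime_less_p) auto
    moreover have "of_nat (n + 2) * bernoulli k = - (\<Sum>i\<le>n. of_nat ((n + 2) choose i) * bernoulli i)"
      unfolding Suc bernoulli.simps by (simp del: of_nat_add binomial_Suc_Suc)
    moreover have "- (\<Sum>i\<le>n. of_nat ((n + 2) choose i) * bernoulli i) \<in> I 0"
      using less Suc by (intro I_uminus I_sum I_0_mult of_nat_in_I_0) auto
    ultimately show ?thesis
      using of_nat_cancel_in_I by metis
  qed simp
qed

text \<open>
  In Faulhaber's formula every term contains a positive power of \<open>p\<close>, and no denominator is
  divisible by \<open>p\<close> in this range.
\<close>

lemma sum_of_powers_in_I: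
  assumes "m < p - 1"
  shows "(\<Sum>x<p. of_nat x ^ m) \<in> I 1"
proof -
  have "(\<Sum>k\<le>m. of_nat (Suc m choose k) * bernoulli k * of_nat p ^ (Suc m - k)) \<in> I 1"
  proof (intro I_sum)
    fix k assume "k \<in> {..m}"
    then show "of_nat (Suc m choose k) * bernoulli k * of_nat p ^ (Suc m - k) \<in> I 1"
      using assms by (intro I_0_mult[where a = 1] I_0_mult[where a = 0] of_nat_in_I_0 bernoulli_in_I_0
          I_antimono[OF of_nat_p_power_in_I]) auto
  qed
  then have "of_nat (Suc m) * (\<Sum>x<p. of_nat x ^ m) \<in> I 1"
    unfolding sum_of_powers_bernoulli .
  moreover have "coprime (Suc m) p"
    using assms by (intro coprime_less_p) auto
  ultimately show ?thesis
    using of_nat_cancel_in_I by blast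
qed

text \<open>The sum \<open>H\<close> of the introduction is the case \<open>k = 2\<close>.\<close>

definition inverse_power_sum :: "nat \<Rightarrow> rat" where
  "inverse_power_sum k = (\<Sum>r\<in>units p. (1 / of_nat r) ^ k)"

lemma units_p_in_I_0: "r \<in> units p \<Longrightarrow> 1 / of_nat r \<in> I 0"
  by (intro inverse_in_I_0 coprime_p_units[of p]) auto

lemma inverse_power_sum_odd:
  assumes "odd k"
  shows "inverse_power_sum k \<in> I 1"
  unfolding inverse_power_sum_def
proof (rule sum_in_I_by_involution[of _ "\<lambda>r. p - r"])
  fix r assume r: "r \<in> units p"
  show r': "p - r \<in> units p"
    using inverse_units_reflect(1)[OF _ r] by simp
  show "p - (p - r) = r"
    using r by (simp add: units_def)
  have *: "x ^ k + y ^ k \<in> I 1" if "x + y \<in> I 1" "x \<in> I 0" "y \<in> I 0" for x y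
  proof -
    have "x ^ k + y ^ k = x ^ k - (- y) ^ k"
      using assms by simp
    also have "\<dots> = (x - (- y)) * (\<Sum>i<k. (- y) ^ (k - Suc i) * x ^ i)"
      by (simp add: power_diff_sumr2)
    also have "\<dots> \<in> I 1"
      using that by (intro I_mult_0[where a = 1] I_sum I_0_mult[where a = 0] I_power I_uminus) auto
    finally show ?thesis .
  qed
  show "(1 / of_nat r) ^ k + (1 / of_nat (p - r)) ^ k \<in> I 1"
    using inverse_units_reflect(2)[OF _ r] r r' by (intro * units_p_in_I_0) auto
qed

lemma inverse_cong_power:
  assumes "r \<in> units p"
  shows "1 / of_nat r - of_nat r ^ (p - 2) \<in> I 1"
proof -
  have "[r ^ (p - 1) = 1] (mod p)"
    using assms prime_p by (intro fermat_theorem) (auto simp: units_def dest: nat_dvd_not_less)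
  then have "int p dvd int (r ^ (p - 1)) - 1"
    by (metis cong_iff_dvd_diff cong_int_iff of_nat_1)
  then obtain z where "int (r ^ (p - 1)) - 1 = int p * z"
    by blast
  then have "of_int (int (r ^ (p - 1))) = (of_nat p * of_int z + 1 :: rat)"
    by (metis diff_eq_eq of_int_1 of_int_add of_int_mult of_int_of_nat_eq)
  moreover have "p - 1 = Suc (p - 2)"
    using p_gt_2 by simp
  ultimately have "of_nat r * of_nat r ^ (p - 2) = (of_nat p * of_int z + 1 :: rat)"
    by simp
  then have "1 / of_nat r - of_nat r ^ (p - 2) = - (1 / of_nat r * (of_nat p ^ 1 * of_int z :: rat))"
    using assms by (simp add: units_def field_simps)
  also have "\<dots> \<in> I 1"
    by (intro I_uminus I_0_mult[where a = 1] I_mult_0[where a = 1] units_p_in_I_0 assms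
        of_nat_p_power_in_I of_int_in_I_0)
  finally show ?thesis .
qed

definition ordered_pair_sum :: rat where
  "ordered_pair_sum = (\<Sum>l\<in>units p. \<Sum>i\<in>{1..<l}. 1 / (of_nat i * of_nat l ^ 2))"

text \<open>
  Replacing \<open>1 / i\<close> by \<open>i\<^bsup>p-2\<^esup>\<close> makes the inner sum a polynomial in \<open>l\<close> by Faulhaber's formula. Summed
  over \<open>l\<close>, the monomials \<open>l\<^bsup>j\<^esup>\<close> with \<open>-1 \<le> j \<le> p - 3\<close> vanish modulo \<open>p\<close> except for \<open>j = 0\<close>, whose
  coefficient contains \<open>B\<^bsub>p-3\<^esub>\<close>.
\<close>

lemma ordered_pair_sum_cong: "ordered_pair_sum - bernoulli (p - 3) \<in> I 1"
proof -
  define t where "t = p - 3"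
  have p: "p = t + 3"
    using p_gt_2 by (simp add: t_def)
  define v where "v l = (1 / of_nat l :: rat)" for l
  define S where "S k = (\<Sum>l\<in>units p. v l ^ 2 * of_nat l ^ (Suc (Suc t) - k))" for k
  define c where "c k = of_nat (Suc (Suc t) choose k) * bernoulli k" for k
  have v: "v l \<in> I 0" if "l \<in> units p" for l
    unfolding v_def by (rule units_p_in_I_0[OF that])
  have c: "c k \<in> I 0" if "k \<le> Suc t" for k
    unfolding c_def using that by (intro I_0_mult of_nat_in_I_0 bernoulli_in_I_0) (simp add: p)
  have "(\<Sum>l\<in>units p. v l ^ 2 * (\<Sum>i\<in>{1..<l}. v i - of_nat i ^ Suc t)) \<in> I 1"
  proof (intro I_sum I_0_mult[where a = 1] I_power v)
    fix l i assume "l \<in> units p" "i \<in> {1..<l}"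
    then have "i \<in> units p"
      by (auto simp: units_p)
    then show "v i - of_nat i ^ Suc t \<in> I 1"
      using inverse_cong_power[of i] by (simp add: v_def p)
  qed
  also have "(\<Sum>l\<in>units p. v l ^ 2 * (\<Sum>i\<in>{1..<l}. v i - of_nat i ^ Suc t))
      = ordered_pair_sum - (\<Sum>l\<in>units p. v l ^ 2 * (\<Sum>i\<in>{1..<l}. of_nat i ^ Suc t))"
    by (simp add: ordered_pair_sum_def v_def sum_subtractf right_diff_distrib sum_distrib_left
        power_one_over mult.commute)
  finally have 1: "ordered_pair_sum - (\<Sum>l\<in>units p. v l ^ 2 * (\<Sum>i\<in>{1..<l}. of_nat i ^ Suc t)) \<in> I 1" .
  have "(\<Sum>i\<in>{1..<l}. of_nat i ^ Suc t) = (\<Sum>i<l. of_nat i ^ Suc t :: rat)" for l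
    by (rule sum.mono_neutral_left) (auto simp: Suc_le_eq)
  then have "of_nat (Suc (Suc t)) * (\<Sum>l\<in>units p. v l ^ 2 * (\<Sum>i\<in>{1..<l}. of_nat i ^ Suc t))
      = (\<Sum>l\<in>units p. v l ^ 2 * (of_nat (Suc (Suc t)) * (\<Sum>i<l. of_nat i ^ Suc t)))"
    by (simp add: sum_distrib_left mult_ac)
  also have "\<dots> = (\<Sum>l\<in>units p. \<Sum>k\<le>Suc t. c k * (v l ^ 2 * of_nat l ^ (Suc (Suc t) - k)))"
    unfolding sum_of_powers_bernoulli c_def by (simp only: sum_distrib_left mult_ac)
  also have "\<dots> = (\<Sum>k\<le>Suc t. c k * S k)"
    unfolding S_def sum_distrib_left by (rule sum.swap)
  also have "\<dots> = (\<Sum>k<t. c k * S k) + c t * S t + c (Suc t) * S (Suc t)"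
    by (simp flip: lessThan_Suc_atMost)
  finally have 2: "of_nat (Suc (Suc t)) * (\<Sum>l\<in>units p. v l ^ 2 * (\<Sum>i\<in>{1..<l}. of_nat i ^ Suc t))
      = (\<Sum>k<t. c k * S k) + c t * S t + c (Suc t) * S (Suc t)" .
  \<comment> \<open>The terms \<open>k < t\<close>, \<open>k = t\<close> and \<open>k = t + 1\<close> carry positive, zero and negative powers of \<open>l\<close>.\<close>
  have cancel: "v l ^ 2 * of_nat l ^ Suc (Suc j) = of_nat l ^ j" if "l \<in> units p" for l j
    using that by (simp add: v_def units_def power_one_over power2_eq_square)
  have S_low: "S k \<in> I 1" if "k < t" for k
  proof -
    have "S k = (\<Sum>l\<in>units p. of_nat l ^ (t - k))"
      unfolding S_def using that cancel[of _ "t - k"] by (intro sum.cong refl) (simp add: Suc_diff_le)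
    also have "\<dots> = (\<Sum>l<p. of_nat l ^ (t - k))"
      using that by (intro sum.mono_neutral_left) (auto simp: units_p Suc_le_eq)
    also have "\<dots> \<in> I 1"
      by (rule sum_of_powers_in_I) (use p in simp)
    finally show ?thesis .
  qed
  have S_mid: "S t = of_nat (Suc (Suc t))"
  proof -
    have "S t = (\<Sum>l\<in>units p. 1)"
      unfolding S_def using cancel[of _ 0] by (intro sum.cong refl) (simp add: Suc_diff_le)
    moreover have "card (units p) = Suc (Suc t)"
      unfolding units_p by (simp add: p)
    ultimately show ?thesis
      by simp
  qed
  have S_high: "S (Suc t) \<in> I 1"
  proof -
    have "S (Suc t) = inverse_power_sum 1"
      unfolding S_def inverse_power_sum_def
      by (intro sum.cong refl) (auto simp: v_def units_def power2_eq_square)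
    then show ?thesis
      using inverse_power_sum_odd[of 1] by simp
  qed
  have c_mid: "c t - bernoulli t \<in> I 1"
  proof -
    have "Suc (Suc t) choose t = Suc (Suc t) choose 2"
      using binomial_symmetric[of t "Suc (Suc t)"] by (simp add: numeral_2_eq_2)
    also have "2 * (of_nat (Suc (Suc t) choose 2) :: rat) = of_nat (Suc t) * of_nat (Suc (Suc t))"
      by (induction t) (simp_all add: numeral_2_eq_2 algebra_simps)
    finally have "c t - bernoulli t = of_nat p ^ 1 * (of_nat t / 2 * bernoulli t)"
      by (simp add: c_def p field_simps del: binomial_Suc_Suc)
    also have "\<dots> \<in> I 1"
      using p by (intro I_mult_0[where a = 1] I_0_mult[where a = 0] of_nat_p_power_in_I half_in_I
          of_nat_in_I_0 bernoulli_in_I_0) simp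
    finally show ?thesis .
  qed
  define X where "X = (\<Sum>l\<in>units p. v l ^ 2 * (\<Sum>i\<in>{1..<l}. of_nat i ^ Suc t))"
  have "(\<Sum>k<t. c k * S k) + of_nat (Suc (Suc t)) * (c t - bernoulli t) + c (Suc t) * S (Suc t) \<in> I 1"
    by (intro I_add I_sum I_0_mult[where a = 1] c c_mid S_low S_high of_nat_in_I_0) auto
  also have "(\<Sum>k<t. c k * S k) + of_nat (Suc (Suc t)) * (c t - bernoulli t) + c (Suc t) * S (Suc t)
      = of_nat (Suc (Suc t)) * (X - bernoulli t)"
    using 2 unfolding X_def[symmetric] S_mid by (simp add: algebra_simps del: of_nat_Suc)
  finally have "X - bernoulli t \<in> I 1"
    by (rule of_nat_cancel_in_I[rotated]) (intro coprime_less_p, simp_all add: p)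
  then have "(ordered_pair_sum - X) + (X - bernoulli t) \<in> I 1"
    using 1 unfolding X_def[symmetric] by (intro I_add)
  then show ?thesis
    by (simp add: t_def)
qed

text \<open>Modulo \<open>p\<close> the third part \<open>k = p - (i + j)\<close> is \<open>- (i + j)\<close>.\<close>

lemma Z_p_cong_ordered_pair_sum: "Z p + 2 * ordered_pair_sum \<in> I 1"
proof -
  define f where "f i l = (1 / (of_nat i * of_nat l ^ 2) :: rat)" for i l
  have "(\<Sum>(i, j, k)\<in>Z_index p. 1 / (of_nat i * of_nat j * of_nat (i + j)))
      = (\<Sum>(i, j, k)\<in>Z_index p. f i (i + j) + f j (j + i))"
  proof (intro sum.cong refl, clarify)
    fix i j k assume "(i, j, k) \<in> Z_index p"
    then have ij: "i > 0" "j > 0"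
      by (auto simp: Z_index_def prime_to_def)
    have "1 / (of_nat i * of_nat j) * (1 / of_nat (i + j))
        = (1 / (of_nat i * of_nat (i + j)) + 1 / (of_nat j * of_nat (j + i))) * (1 / of_nat (i + j) :: rat)"
      using inverse_mult_eq_sum[OF ij] by (rule arg_cong)
    also have "\<dots> = f i (i + j) + f j (j + i)"
      by (simp add: f_def power2_eq_square add_divide_distrib add.commute[of j] mult.assoc del: of_nat_add)
    finally have "1 / (of_nat i * of_nat j) * (1 / of_nat (i + j)) = f i (i + j) + f j (j + i)" .
    then show "1 / (of_nat i * of_nat j * of_nat (i + j)) = f i (i + j) + f j (j + i)"
      by simp
  qed
  also have "\<dots> = (\<Sum>(i, j, k)\<in>Z_index p. f i (i + j)) + (\<Sum>(i, j, k)\<in>Z_index p. f j (j + i))"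
    by (simp add: sum.distrib case_prod_unfold)
  also have "(\<Sum>(i, j, k)\<in>Z_index p. f j (j + i)) = (\<Sum>(i, j, k)\<in>Z_index p. f i (i + j))"
    by (rule sum_Z_index_swap)
  also have "\<dots> = (\<Sum>(i, l) | (i, l) \<in> unit_pairs p \<and> i < l. f i l)"
    by (rule sum_Z_index_partial_sums)
  also have "\<dots> = (\<Sum>(l, i)\<in>Sigma (units p) (\<lambda>l. {1..<l}). f i l)"
    by (rule sum.reindex_bij_witness[of _ prod.swap prod.swap])
      (auto simp: unit_pairs_def units_p coprime_diff_iff intro!: coprime_less_p)
  also have "\<dots> = ordered_pair_sum"
    by (simp add: ordered_pair_sum_def f_def sum.Sigma)
  finally have "Z p + 2 * ordered_pair_sum
      = (\<Sum>(i, j, k)\<in>Z_index p. 1 / (of_nat i * of_nat j) * (1 / of_nat k + 1 / of_nat (i + j)))"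
    by (simp add: Z_altdef case_prod_unfold distrib_left sum.distrib)
  also have "\<dots> \<in> I 1"
  proof (intro I_sum, clarify)
    fix i j k assume "(i, j, k) \<in> Z_index p"
    then have "k \<in> units p" "i + j = p - k" "coprime (i * j) p"
      by (auto simp: Z_index_def prime_to_def units_def)
    then show "1 / (of_nat i * of_nat j) * (1 / of_nat k + 1 / of_nat (i + j)) \<in> I 1"
      using inverse_units_reflect(2)[of p k] inverse_in_I_0[of "i * j"]
      by (intro I_0_mult[where a = 1]) (auto simp del: of_nat_add)
  qed
  finally show ?thesis .
qed

lemma unit_pair_sum_p: "unit_pair_sum p = inverse_power_sum 1 ^ 2 - inverse_power_sum 2"
proof -
  have "coprime (int i - int l) (int p) \<longleftrightarrow> i \<noteq> l" if il: "i \<in> units p" "l \<in> units p" for i l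
  proof (cases i l rule: linorder_cases)
    case less
    then show ?thesis
      using il coprime_diff_iff[of i l p] coprime_less_p[of "l - i"] by (simp add: units_p)
  next
    case equal
    then show ?thesis
      using p_gt_2 by simp
  next
    case greater
    then have "coprime (int l - int i) (int p)"
      using il coprime_diff_iff[of l i p] coprime_less_p[of "i - l"] by (simp add: units_p)
    then show ?thesis
      using greater coprime_minus_left_iff[of "int l - int i" "int p"] by simp
  qed
  then have "unit_pair_sum p = (\<Sum>i\<in>units p. \<Sum>l\<in>units p. if i \<noteq> l then 1 / (of_nat i * of_nat l) else 0)"
    unfolding unit_pair_sum_def sum_unit_pairs by (intro sum.cong refl if_cong) auto
  also have "\<dots> = (\<Sum>i\<in>units p. \<Sum>l\<in>units p. 1 / of_nat i * (1 / of_nat l)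
      - (if l = i then (1 / of_nat i) ^ 2 else 0))"
    by (intro sum.cong refl) (auto simp: power2_eq_square)
  also have "\<dots> = inverse_power_sum 1 ^ 2 - inverse_power_sum 2"
    by (simp add: sum_subtractf inverse_power_sum_def power2_eq_square sum_product)
  finally show ?thesis .
qed

text \<open>
  The square of the harmonic sum is divisible by \<open>p\<^sup>2\<close>, so \<open>p Z(p) = 3 X(p)\<close> determines \<open>3 H\<close> modulo \<open>p\<^sup>2\<close>
  from \<open>Z(p)\<close> modulo \<open>p\<close>.
\<close>

lemma inverse_square_sum_cong: "3 * inverse_power_sum 2 - 2 * of_nat p * bernoulli (p - 3) \<in> I 2"
proof -
  define h where "h = inverse_power_sum 1"
  have h: "h \<in> I 1"
    unfolding h_def by (rule inverse_power_sum_odd) simp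
  have 1: "3 * (h * h) \<in> I (1 + 1)"
    by (intro I_0_mult I_mult h) simp
  have "Z p + 2 * ordered_pair_sum - 2 * (ordered_pair_sum - bernoulli (p - 3)) \<in> I 1"
    by (intro I_diff Z_p_cong_ordered_pair_sum I_0_mult[where a = 1] ordered_pair_sum_cong) simp
  then have "of_nat p ^ 1 * (Z p + 2 * bernoulli (p - 3)) \<in> I (1 + 1)"
    unfolding p_power_mult_in_I_iff by simp
  then have "3 * (h * h) - of_nat p * (Z p + 2 * bernoulli (p - 3)) \<in> I (1 + 1)"
    using I_diff[OF 1] by simp
  also have "3 * (h * h) - of_nat p * (Z p + 2 * bernoulli (p - 3))
      = 3 * inverse_power_sum 2 - 2 * of_nat p * bernoulli (p - 3)"
    using n_times_Z[of p] unfolding unit_pair_sum_p h_def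
    by (simp add: distrib_left power2_eq_square)
  finally show ?thesis
    by (simp add: numeral_2_eq_2)
qed

end

section \<open>Pairs of units modulo a product of two primes\<close>

text \<open>Inclusion and exclusion over the pairs of cells of a grid that share a row or a column.\<close>

lemma sum_pairs_distinct_coordinates:
  fixes f :: "'a \<Rightarrow> 'b \<Rightarrow> rat"
  assumes "finite R" and "finite S"
  shows "(\<Sum>r\<in>R. \<Sum>s\<in>S. \<Sum>r'\<in>R. \<Sum>s'\<in>S. if r \<noteq> r' \<and> s \<noteq> s' then f r s * f r' s' else 0)
    = (\<Sum>r\<in>R. \<Sum>s\<in>S. f r s) ^ 2 - (\<Sum>r\<in>R. (\<Sum>s\<in>S. f r s) ^ 2)
      - (\<Sum>s\<in>S. (\<Sum>r\<in>R. f r s) ^ 2) + (\<Sum>r\<in>R. \<Sum>s\<in>S. f r s ^ 2)"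
proof -
  define T where "T = (\<Sum>r\<in>R. \<Sum>s\<in>S. f r s)"
  have "(\<Sum>r'\<in>R. \<Sum>s'\<in>S. if r \<noteq> r' \<and> s \<noteq> s' then f r s * f r' s' else 0)
      = f r s * T - f r s * (\<Sum>s'\<in>S. f r s') - f r s * (\<Sum>r'\<in>R. f r' s) + f r s ^ 2"
    if "r \<in> R" "s \<in> S" for r s
  proof -
    have "(\<Sum>r'\<in>R. \<Sum>s'\<in>S. if r \<noteq> r' \<and> s \<noteq> s' then f r s * f r' s' else 0)
        = (\<Sum>r'\<in>R. \<Sum>s'\<in>S. f r s * f r' s' - (if r' = r then f r s * f r' s' else 0)
          - (if s' = s then f r s * f r' s' else 0)
          + (if r' = r then if s' = s then f r s * f r' s' else 0 else 0))"
      by (intro sum.cong refl) auto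
    also have "\<dots> = (\<Sum>r'\<in>R. (\<Sum>s'\<in>S. f r s * f r' s') - (if r' = r then \<Sum>s'\<in>S. f r s * f r' s' else 0)
          - f r s * f r' s + (if r' = r then f r s * f r' s else 0))"
      using assms that by (intro sum.cong refl) (simp add: sum.distrib sum_subtractf)
    also have "\<dots> = f r s * T - f r s * (\<Sum>s'\<in>S. f r s') - f r s * (\<Sum>r'\<in>R. f r' s) + f r s ^ 2"
      using assms that by (simp add: sum.distrib sum_subtractf T_def sum_distrib_left power2_eq_square)
    finally show ?thesis .
  qed
  then have "(\<Sum>r\<in>R. \<Sum>s\<in>S. \<Sum>r'\<in>R. \<Sum>s'\<in>S. if r \<noteq> r' \<and> s \<noteq> s' then f r s * f r' s' else 0)
      = (\<Sum>r\<in>R. \<Sum>s\<in>S. f r s * T - f r s * (\<Sum>s'\<in>S. f r s') - f r s * (\<Sum>r'\<in>R. f r' s) + f r s ^ 2)"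
    by (intro sum.cong refl)
  also have "\<dots> = (\<Sum>r\<in>R. \<Sum>s\<in>S. f r s * T) - (\<Sum>r\<in>R. \<Sum>s\<in>S. f r s * (\<Sum>s'\<in>S. f r s'))
      - (\<Sum>r\<in>R. \<Sum>s\<in>S. f r s * (\<Sum>r'\<in>R. f r' s)) + (\<Sum>r\<in>R. \<Sum>s\<in>S. f r s ^ 2)"
    by (simp add: sum.distrib sum_subtractf)
  also have "(\<Sum>r\<in>R. \<Sum>s\<in>S. f r s * (\<Sum>r'\<in>R. f r' s)) = (\<Sum>s\<in>S. \<Sum>r\<in>R. f r s * (\<Sum>r'\<in>R. f r' s))"
    by (rule sum.swap)
  finally show ?thesis
    by (simp only: T_def power2_eq_square sum_distrib_right[symmetric])
qed

lemma crt_enumeration: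
  fixes p q :: nat
  assumes "coprime p q" and "p > 0" and "q > 0"
  obtains w :: "nat \<Rightarrow> nat \<Rightarrow> nat" where
    "\<And>r s. r < p \<Longrightarrow> s < q \<Longrightarrow> w r s < p * q \<and> w r s mod p = r \<and> w r s mod q = s"
    and "\<And>x. x < p * q \<Longrightarrow> w (x mod p) (x mod q) = x"
proof -
  have ex1: "\<exists>!x. x < p * q \<and> [x = r] (mod p) \<and> [x = s] (mod q)" for r s
    using assms by (intro binary_chinese_remainder_unique_nat) auto
  define w where "w r s = (THE x. x < p * q \<and> [x = r] (mod p) \<and> [x = s] (mod q))" for r s
  have w: "w r s < p * q \<and> [w r s = r] (mod p) \<and> [w r s = s] (mod q)" for r s
    unfolding w_def by (rule theI'[OF ex1])
  show thesis
  proof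
    show "w r s < p * q \<and> w r s mod p = r \<and> w r s mod q = s" if "r < p" "s < q" for r s
      using w[of r s] that by (simp add: cong_def)
    show "w (x mod p) (x mod q) = x" if "x < p * q" for x
      unfolding w_def using that by (intro the1_equality ex1) (simp add: cong_def)
  qed
qed

lemma dvd_int_diff_iff: "int p dvd int x - int y \<longleftrightarrow> x mod p = y mod p"
  by (metis mod_eq_dvd_iff of_nat_eq_iff zmod_int)

context odd_prime
begin

lemma square_in_I_2: "x \<in> I 1 \<Longrightarrow> x ^ 2 \<in> I 2"
  using I_mult[of x 1 x 1] by (simp add: power2_eq_square numeral_2_eq_2)

text \<open>
  Second-order terms vanish modulo \<open>p\<^sup>2\<close>; the first-order ones add up to the multiple \<open>\<kappa>\<close> of \<open>p\<close>, which
  does not depend on \<open>r\<close>.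
\<close>

lemma sum_progression_cong:
  fixes r q :: nat
  assumes r: "r \<in> units p"
  defines "V \<equiv> 1 / of_nat r :: rat" and "\<kappa> \<equiv> of_nat p * (of_nat q * (of_nat q - 1) / 2) :: rat"
  shows "(\<Sum>t<q. 1 / of_nat (r + p * t)) - (of_nat q * V - \<kappa> * V ^ 2) \<in> I 2"
    and "(\<Sum>t<q. (1 / of_nat (r + p * t)) ^ 2) - (of_nat q * V ^ 2 - 2 * \<kappa> * V ^ 3) \<in> I 2"
proof -
  define y where "y t = 1 / of_nat (r + p * t) - (V - of_nat (p * t) * V ^ 2)" for t
  have V: "V \<in> I 0"
    unfolding V_def by (rule units_p_in_I_0[OF r])
  have y: "y t \<in> I 2" for t
    unfolding y_def V_def using inverse_add_cong(2)[of r 0 "p * t"] coprime_p_units[of p r] r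
    by (simp add: numeral_2_eq_2)
  have pt: "of_nat (p * t) \<in> I 1" for t
    by (rule of_nat_in_I) simp
  have kappa_sum: "(\<Sum>t<q. of_nat (p * t)) = \<kappa>"
    by (simp add: \<kappa>_def sum_lessThan_of_nat flip: sum_distrib_left)
  have "(\<Sum>t<q. y t) \<in> I 2"
    using y by (rule I_sum)
  also have "(\<Sum>t<q. y t)
      = (\<Sum>t<q. 1 / of_nat (r + p * t)) - (of_nat q * V - (\<Sum>t<q. of_nat (p * t)) * V ^ 2)"
    by (simp add: y_def sum_subtractf sum_distrib_right)
  finally show "(\<Sum>t<q. 1 / of_nat (r + p * t)) - (of_nat q * V - \<kappa> * V ^ 2) \<in> I 2"
    unfolding kappa_sum .
  have "(\<Sum>t<q. y t * (y t + 2 * (V - of_nat (p * t) * V ^ 2)) + of_nat (p * t) ^ 2 * V ^ 4) \<in> I 2"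
    using y pt V I_antimono[OF y, of 0] I_antimono[OF pt, of 0]
    by (intro I_sum I_add I_mult_0[where a = 2] I_diff I_0_mult[where a = 0] I_power square_in_I_2) auto
  also have "(\<Sum>t<q. y t * (y t + 2 * (V - of_nat (p * t) * V ^ 2)) + of_nat (p * t) ^ 2 * V ^ 4)
      = (\<Sum>t<q. (1 / of_nat (r + p * t)) ^ 2 - (V ^ 2 - 2 * of_nat (p * t) * V ^ 3))"
  proof (intro sum.cong refl)
    fix t
    define g where "g = (1 / of_nat (r + p * t) :: rat)"
    define d where "d = (of_nat (p * t) :: rat)"
    show "y t * (y t + 2 * (V - of_nat (p * t) * V ^ 2)) + of_nat (p * t) ^ 2 * V ^ 4
        = (1 / of_nat (r + p * t)) ^ 2 - (V ^ 2 - 2 * of_nat (p * t) * V ^ 3)"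
      unfolding y_def g_def[symmetric] d_def[symmetric]
      by (simp add: algebra_simps power2_eq_square power3_eq_cube power4_eq_xxxx)
  qed
  also have "\<dots> = (\<Sum>t<q. (1 / of_nat (r + p * t)) ^ 2)
      - (of_nat q * V ^ 2 - 2 * (\<Sum>t<q. of_nat (p * t)) * V ^ 3)"
    by (simp add: sum_subtractf sum_distrib_right sum_distrib_left)
  finally show "(\<Sum>t<q. (1 / of_nat (r + p * t)) ^ 2) - (of_nat q * V ^ 2 - 2 * \<kappa> * V ^ 3) \<in> I 2"
    unfolding kappa_sum .
qed

text \<open>
  Put \<open>f r s = 1 / w\<close> where \<open>w\<close> has residues \<open>r\<close> modulo \<open>p\<close> and \<open>s\<close> modulo \<open>q\<close>. Each column is the harmonic
  sum modulo \<open>p\<close>, so the squares of the columns and of the total vanish modulo \<open>p\<^sup>2\<close>. A row,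
  completed by the entry \<open>z r = f r 0\<close>, runs through the progression \<open>r + p t\<close> for \<open>t < q\<close>. Its square
  produces the mixed term \<open>2 z r / r\<close>. Its factors \<open>z r\<close> and \<open>1 / r\<close> are congruent modulo \<open>p\<close>, so it is
  replaced by two squares by means of \<open>(1 / r - z r)\<^sup>2 \<equiv> 0\<close> modulo \<open>p\<^sup>2\<close>. Summation over \<open>r\<close> then only
  involves the inverse squares of the \<open>r\<close> and of the multiples of \<open>q\<close>.
\<close>

lemma unit_pair_sum_prime_product_cong:
  assumes "prime q" and "q \<noteq> p"
  shows "unit_pair_sum (p * q)
    - (2 - of_nat q) * (of_nat q - 1 / of_nat q ^ 2) * inverse_power_sum 2 \<in> I 2"
proof -
  define Q where "Q = (of_nat q :: rat)"
  have cop: "coprime p q" and q1: "q > 1" and p1: "p > 1"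
    using primes_coprime[OF prime_p assms(1)] assms(2) prime_gt_1_nat[OF assms(1)] p_gt_2 by auto
  have Q0: "Q \<noteq> 0" "Q \<in> I 0"
    using q1 by (simp_all add: Q_def)
  obtain w where w: "\<And>r s. r < p \<Longrightarrow> s < q \<Longrightarrow> w r s < p * q \<and> w r s mod p = r \<and> w r s mod q = s"
    and w_mod: "\<And>x. x < p * q \<Longrightarrow> w (x mod p) (x mod q) = x"
    using crt_enumeration[OF cop] q1 p1 by (metis gr_implies_not0 not_gr0)
  have prime_coprime: "coprime x (int p * int q) \<longleftrightarrow> \<not> int p dvd x \<and> \<not> int q dvd x" for x
    using prime_p assms(1) prime_imp_coprime[of "int p" x] prime_imp_coprime[of "int q" x]
    by (auto simp: coprime_commute[of x] dest: coprime_common_divisor)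
  have units_pq: "x \<in> units (p * q) \<longleftrightarrow> x < p * q \<and> x mod p \<in> units p \<and> x mod q \<in> {1..<q}" for x
  proof -
    have "coprime x (p * q) \<longleftrightarrow> \<not> p dvd x \<and> \<not> q dvd x"
      using prime_coprime[of "int x"] by (metis coprime_int_iff of_nat_dvd_iff of_nat_mult)
    then show ?thesis
      using p1 q1 by (auto simp: units_def units_p[unfolded units_def] dvd_eq_mod_eq_0 Suc_le_eq intro!: Nat.gr0I)
  qed
  have sum_units: "(\<Sum>x\<in>units (p * q). F x) = (\<Sum>r\<in>units p. \<Sum>s\<in>{1..<q}. F (w r s))"
    for F :: "nat \<Rightarrow> rat"
    unfolding sum.cartesian_product
    by (rule sum.reindex_bij_witness[of _ "\<lambda>(r, s). w r s" "\<lambda>x. (x mod p, x mod q)"])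
      (use w w_mod in \<open>auto simp: units_pq units_p\<close>)
  have sum_progression: "(\<Sum>s<q. F (w r s)) = (\<Sum>t<q. F (r + p * t))" if "r \<in> units p"
    for r and F :: "nat \<Rightarrow> rat"
  proof (rule sum.reindex_bij_witness[of _ "\<lambda>t. (r + p * t) mod q" "\<lambda>s. w r s div p"])
    have r: "r < p"
      using that by (simp add: units_p)
    fix s assume "s \<in> {..<q}"
    with w[OF r] have ws: "w r s < p * q" "w r s mod p = r" "w r s mod q = s"
      by auto
    then have eq: "r + p * (w r s div p) = w r s"
      by (metis mod_mult_div_eq)
    show "(r + p * (w r s div p)) mod q = s" "F (r + p * (w r s div p)) = F (w r s)"
      unfolding eq using ws by simp_all
    show "w r s div p \<in> {..<q}"
      using ws(1) by (simp add: less_mult_imp_div_less mult.commute)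
  next
    have r: "r < p"
      using that by (simp add: units_p)
    fix t assume t: "t \<in> {..<q}"
    have "r + p * t < p * Suc t"
      using r by simp
    also have "\<dots> \<le> p * q"
      using t by (intro mult_le_mono) auto
    finally have "w r ((r + p * t) mod q) = r + p * t"
      using w_mod[of "r + p * t"] r by simp
    then show "w r ((r + p * t) mod q) div p = t"
      using r by simp
    show "(r + p * t) mod q \<in> {..<q}"
      using q1 by simp
  qed
  have sum_multiples: "(\<Sum>r\<in>units p. F (w r 0)) = (\<Sum>k\<in>units p. F (q * k))" for F :: "nat \<Rightarrow> rat"
  proof (rule sum.reindex_bij_witness[of _ "\<lambda>k. (q * k) mod p" "\<lambda>r. w r 0 div q"])
    fix r assume r: "r \<in> units p"
    with w[of r 0] q1 have wr: "w r 0 < p * q" "w r 0 mod p = r" "w r 0 mod q = 0"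
      by (auto simp: units_p)
    then have eq: "q * (w r 0 div q) = w r 0"
      by auto
    show "(q * (w r 0 div q)) mod p = r" "F (q * (w r 0 div q)) = F (w r 0)"
      unfolding eq using wr by simp_all
    have "w r 0 div q < p"
      using wr(1) by (simp add: less_mult_imp_div_less)
    moreover have "w r 0 div q \<noteq> 0"
    proof
      assume "w r 0 div q = 0"
      with eq wr(2) r show False
        by (simp add: units_p)
    qed
    ultimately show "w r 0 div q \<in> units p"
      by (simp add: units_p)
  next
    fix k assume k: "k \<in> units p"
    then have "q * k < p * q"
      using q1 by (simp add: units_p mult.commute)
    then have "w ((q * k) mod p) 0 = q * k"
      using w_mod[of "q * k"] by simp
    then show "w ((q * k) mod p) 0 div q = k"
      using q1 by simp
    have "\<not> p dvd q * k"
      using k cop by (auto simp: units_p coprime_dvd_mult_right_iff dest: nat_dvd_not_less)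
    then show "(q * k) mod p \<in> units p"
      using p1 by (auto simp: units_p Suc_le_eq dvd_eq_mod_eq_0)
  qed
  define f where "f r s = (1 / of_nat (w r s) :: rat)" for r s
  define v where "v r = (1 / of_nat r :: rat)" for r
  define z where "z r = f r 0" for r
  define row where "row r = (\<Sum>s\<in>{1..<q}. f r s)" for r
  define col where "col s = (\<Sum>r\<in>units p. f r s)" for s
  have v0: "v r \<in> I 0" if "r \<in> units p" for r
    unfolding v_def by (rule units_p_in_I_0[OF that])
  have f_v: "f r s - v r \<in> I 1" if "r \<in> units p" "s < q" for r s
  proof -
    have "w r s = r + p * (w r s div p)"
      using w[of r s] that by (metis atLeastLessThan_iff mod_mult_div_eq units_p)
    then show ?thesis
      using inverse_add_cong(1)[of r 0 "p * (w r s div p)"] coprime_p_units[of p r] that(1)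
      by (simp add: f_def v_def)
  qed
  have f0: "f r s \<in> I 0" if "r \<in> units p" "s < q" for r s
    using I_add[OF I_antimono[OF f_v[OF that], of 0] v0[OF that(1)]] by simp
  have col: "col s \<in> I 1" if "s < q" for s
  proof -
    have "(\<Sum>r\<in>units p. f r s - v r) + inverse_power_sum 1 \<in> I 1"
      using that f_v inverse_power_sum_odd[of 1] by (intro I_add I_sum) auto
    then show ?thesis
      by (simp add: col_def inverse_power_sum_def v_def sum_subtractf)
  qed
  have total: "(\<Sum>r\<in>units p. row r) \<in> I 1"
    unfolding row_def using col by (subst sum.swap) (auto intro!: I_sum simp flip: col_def)
  have coprime_w: "coprime (int (w r s) - int (w r' s')) (int (p * q)) \<longleftrightarrow> r \<noteq> r' \<and> s \<noteq> s'"
    if "r \<in> units p" "r' \<in> units p" "s \<in> {1..<q}" "s' \<in> {1..<q}" for r s r' s'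
    unfolding of_nat_mult prime_coprime dvd_int_diff_iff
    using that w[of r s] w[of r' s'] by (simp add: units_p)
  have "unit_pair_sum (p * q) = (\<Sum>r\<in>units p. \<Sum>s\<in>{1..<q}. \<Sum>r'\<in>units p. \<Sum>s'\<in>{1..<q}.
      if r \<noteq> r' \<and> s \<noteq> s' then f r s * f r' s' else 0)"
    unfolding unit_pair_sum_def sum_unit_pairs sum_units
    by (intro sum.cong refl if_cong coprime_w) (auto simp: f_def)
  also have "\<dots> = (\<Sum>r\<in>units p. row r) ^ 2 - (\<Sum>r\<in>units p. row r ^ 2) - (\<Sum>s\<in>{1..<q}. col s ^ 2)
      + (\<Sum>r\<in>units p. \<Sum>s\<in>{1..<q}. f r s ^ 2)"
    unfolding row_def col_def by (rule sum_pairs_distinct_coordinates) auto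
  finally have X: "unit_pair_sum (p * q) = (\<Sum>r\<in>units p. row r) ^ 2 - (\<Sum>r\<in>units p. row r ^ 2)
      - (\<Sum>s\<in>{1..<q}. col s ^ 2) + (\<Sum>r\<in>units p. \<Sum>s\<in>{1..<q}. f r s ^ 2)" .
  have small: "(\<Sum>r\<in>units p. row r) ^ 2 - (\<Sum>s\<in>{1..<q}. col s ^ 2) \<in> I 2"
    by (intro I_diff square_in_I_2 total I_sum col) auto
  define \<kappa> where "\<kappa> = of_nat p * (Q * (Q - 1) / 2)"
  have \<kappa>: "\<kappa> \<in> I 1"
    unfolding \<kappa>_def using of_nat_p_power_in_I[of 1] Q0
    by (intro I_mult_0[where a = 1] half_in_I I_0_mult[where a = 0] I_diff) auto
  \<comment> \<open>The coefficient with which the cubic terms \<open>\<kappa> / r\<^sup>3\<close> enter; they die on summation over \<open>r\<close>.\<close>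
  define c where "c = 2 * (Q - 2)"
  have c0: "c \<in> I 0"
    unfolding c_def using Q0 by (intro I_0_mult I_diff) auto
  have main: "(\<Sum>s\<in>{1..<q}. f r s ^ 2) - row r ^ 2
      - ((2 * Q - Q ^ 2) * v r ^ 2 + (Q - 2) * z r ^ 2 + c * \<kappa> * v r ^ 3) \<in> I 2"
    if r: "r \<in> units p" for r
  proof -
    define V where "V = v r"
    define B where "B = (\<Sum>t<q. 1 / of_nat (r + p * t) :: rat)"
    define B2 where "B2 = (\<Sum>t<q. (1 / of_nat (r + p * t)) ^ 2 :: rat)"
    have V: "V \<in> I 0"
      unfolding V_def by (rule v0[OF r])
    have B: "B - (Q * V - \<kappa> * V ^ 2) \<in> I 2" and B2: "B2 - (Q * V ^ 2 - 2 * \<kappa> * V ^ 3) \<in> I 2"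
      using sum_progression_cong[OF r, of q] by (simp_all add: B_def B2_def Q_def V_def v_def \<kappa>_def)
    have insert0: "{..<q} = insert 0 {1..<q}"
      using q1 by auto
    have row: "row r = B - z r"
      using sum_progression[OF r, of "\<lambda>x. 1 / of_nat x"]
      by (simp add: row_def B_def z_def f_def insert0)
    have squares: "(\<Sum>s\<in>{1..<q}. f r s ^ 2) = B2 - z r ^ 2"
      using sum_progression[OF r, of "\<lambda>x. (1 / of_nat x) ^ 2"]
      by (simp add: B2_def z_def f_def insert0)
    \<comment> \<open>The remaining identity is polynomial in \<open>V\<close> and the errors \<open>e\<close>, \<open>b\<close>, \<open>b2\<close>.\<close>
    define e where "e = z r - V"
    have e: "e \<in> I 1"
      unfolding e_def z_def V_def using f_v[OF r, of 0] q1 by simp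
    define b where "b = B - (Q * V - \<kappa> * V ^ 2)"
    define b2 where "b2 = B2 - (Q * V ^ 2 - 2 * \<kappa> * V ^ 3)"
    have ve: "z r = V + e" "B = Q * V - \<kappa> * V ^ 2 + b" "B2 = Q * V ^ 2 - 2 * \<kappa> * V ^ 3 + b2"
      by (simp_all add: e_def b_def b2_def)
    have bI: "b \<in> I 2" "b2 \<in> I 2"
      unfolding b_def b2_def by (rule B B2)+
    have "(\<Sum>s\<in>{1..<q}. f r s ^ 2) - row r ^ 2
        - ((2 * Q - Q ^ 2) * v r ^ 2 + (Q - 2) * z r ^ 2 + c * \<kappa> * v r ^ 3)
      = b2 - b * (2 * (Q * V - \<kappa> * V ^ 2 - z r) + b) - Q * e ^ 2
        - 2 * V ^ 2 * (\<kappa> * e) - \<kappa> ^ 2 * V ^ 4"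
      unfolding squares row V_def[symmetric] ve c_def
      by (simp add: algebra_simps power2_eq_square power3_eq_cube power4_eq_xxxx)
    also have "\<dots> \<in> I 2"
    proof -
      have "\<kappa> * e \<in> I 2"
        using I_mult[OF \<kappa> e] by (simp add: numeral_2_eq_2)
      moreover have "z r \<in> I 0"
        unfolding z_def using f0[OF r, of 0] q1 by simp
      moreover have "b \<in> I 0" "\<kappa> \<in> I 0"
        using bI(1) \<kappa> I_antimono by blast+
      ultimately show ?thesis
        using bI Q0 V
        by (intro I_diff[of _ 2] I_mult_0[of b 2] I_mult_0[of "\<kappa> ^ 2" 2] I_0_mult[of _ "e ^ 2" 2]
            I_0_mult[of _ "\<kappa> * e" 2] square_in_I_2[OF e] square_in_I_2[OF \<kappa>] I_add[of _ 0] I_0_mult[of _ _ 0] I_diff[of _ 0] I_power)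
          auto
    qed
    finally show ?thesis .
  qed
  have "(\<Sum>r\<in>units p. z r ^ 2) = (\<Sum>k\<in>units p. (1 / of_nat (q * k)) ^ 2)"
    unfolding z_def f_def by (rule sum_multiples)
  also have "\<dots> = inverse_power_sum 2 / Q ^ 2"
    by (simp add: inverse_power_sum_def Q_def sum_divide_distrib power_divide power_mult_distrib mult.commute)
  finally have z_sum: "(\<Sum>r\<in>units p. z r ^ 2) = inverse_power_sum 2 / Q ^ 2" .
  define W where "W = (\<Sum>r\<in>units p. (\<Sum>s\<in>{1..<q}. f r s ^ 2) - row r ^ 2)"
  have "(\<Sum>r\<in>units p. (\<Sum>s\<in>{1..<q}. f r s ^ 2) - row r ^ 2
      - ((2 * Q - Q ^ 2) * v r ^ 2 + (Q - 2) * z r ^ 2 + c * \<kappa> * v r ^ 3)) \<in> I 2"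
    by (rule I_sum[OF main])
  also have "(\<Sum>r\<in>units p. (\<Sum>s\<in>{1..<q}. f r s ^ 2) - row r ^ 2
      - ((2 * Q - Q ^ 2) * v r ^ 2 + (Q - 2) * z r ^ 2 + c * \<kappa> * v r ^ 3))
      = W - ((2 * Q - Q ^ 2) * (\<Sum>r\<in>units p. v r ^ 2) + (Q - 2) * (\<Sum>r\<in>units p. z r ^ 2)
          + c * \<kappa> * (\<Sum>r\<in>units p. v r ^ 3))"
    by (simp only: W_def sum_subtractf sum.distrib sum_distrib_left)
  finally have main_sum: "W - ((2 * Q - Q ^ 2) * inverse_power_sum 2 + (Q - 2) * (inverse_power_sum 2 / Q ^ 2)
      + c * \<kappa> * inverse_power_sum 3) \<in> I 2"
    unfolding z_sum by (simp add: v_def inverse_power_sum_def)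
  have "\<kappa> * inverse_power_sum 3 \<in> I 2"
  proof -
    have "inverse_power_sum 3 \<in> I 1"
      by (rule inverse_power_sum_odd) simp
    then show ?thesis
      using I_mult[OF \<kappa>, of "inverse_power_sum 3" 1] by (simp add: numeral_2_eq_2)
  qed
  then have cubic: "c * (\<kappa> * inverse_power_sum 3) \<in> I 2"
    by (rule I_0_mult[OF c0])
  have "((\<Sum>r\<in>units p. row r) ^ 2 - (\<Sum>s\<in>{1..<q}. col s ^ 2))
      + (W - ((2 * Q - Q ^ 2) * inverse_power_sum 2 + (Q - 2) * (inverse_power_sum 2 / Q ^ 2)
        + c * \<kappa> * inverse_power_sum 3)) + c * (\<kappa> * inverse_power_sum 3) \<in> I 2"
    by (rule I_add[OF I_add[OF small main_sum] cubic])
  also have "((\<Sum>r\<in>units p. row r) ^ 2 - (\<Sum>s\<in>{1..<q}. col s ^ 2))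
      + (W - ((2 * Q - Q ^ 2) * inverse_power_sum 2 + (Q - 2) * (inverse_power_sum 2 / Q ^ 2)
        + c * \<kappa> * inverse_power_sum 3)) + c * (\<kappa> * inverse_power_sum 3)
      = unit_pair_sum (p * q) - ((2 * Q - Q ^ 2) * inverse_power_sum 2 + (Q - 2) * (inverse_power_sum 2 / Q ^ 2))"
    unfolding X W_def sum_subtractf by simp
  also have "(2 * Q - Q ^ 2) * inverse_power_sum 2 + (Q - 2) * (inverse_power_sum 2 / Q ^ 2)
      = (2 - Q) * (Q - 1 / Q ^ 2) * inverse_power_sum 2"
    using Q0 by (simp add: field_simps power2_eq_square)
  finally show ?thesis
    unfolding Q_def .
qed

lemma Z_prime_product_cong:
  assumes "prime q" and "q \<noteq> p"
  shows "Z (p * q) - 2 * (2 - of_nat q) * (1 - 1 / of_nat q ^ 3) * bernoulli (p - 3) \<in> I 1"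
proof -
  define Q where "Q = (of_nat q :: rat)"
  define A where "A = (2 - Q) * (Q - 1 / Q ^ 2)"
  define H where "H = inverse_power_sum 2"
  define B where "B = bernoulli (p - 3)"
  have cop: "coprime q p" and Q: "Q \<noteq> 0"
    using primes_coprime[OF assms(1) prime_p assms(2)] prime_gt_0_nat[OF assms(1)] by (auto simp: Q_def)
  have "(1 / Q) ^ 2 \<in> I 0"
    unfolding Q_def by (intro I_power inverse_in_I_0 cop)
  then have A: "A \<in> I 0"
    unfolding A_def Q_def by (intro I_0_mult I_diff) (simp_all add: power_one_over)
  have "3 * (unit_pair_sum (p * q) - A * H) + A * (3 * H - 2 * of_nat p * B) \<in> I 2"
    unfolding A_def H_def B_def Q_def
    using unit_pair_sum_prime_product_cong[OF assms] inverse_square_sum_cong A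
    by (intro I_add I_0_mult[where a = 2]) (simp_all add: A_def Q_def)
  also have "3 * (unit_pair_sum (p * q) - A * H) + A * (3 * H - 2 * of_nat p * B)
      = of_nat (p * q) * Z (p * q) - 2 * A * of_nat p * B"
    using n_times_Z[of "p * q"] by (simp add: algebra_simps)
  also have "\<dots> = of_nat p ^ 1 * (of_nat q * (Z (p * q) - 2 * (2 - Q) * (1 - 1 / Q ^ 3) * B))"
    using Q by (simp add: A_def field_simps power2_eq_square power3_eq_cube flip: Q_def)
  finally have "of_nat q * (Z (p * q) - 2 * (2 - Q) * (1 - 1 / Q ^ 3) * B) \<in> I 1"
    using p_power_mult_in_I_iff[of 1 _ 1] by (simp add: numeral_2_eq_2)
  then show ?thesis
    unfolding Q_def B_def by (rule of_nat_cancel_in_I[OF cop])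
qed

lemma Z_in_I_0:
  assumes "p dvd n"
  shows "Z n \<in> I 0"
  unfolding Z_altdef
proof (intro I_sum, clarify)
  fix i j k assume "(i, j, k) \<in> Z_index n"
  then have "coprime (i * j * k) p"
    using assms coprime_divisors[of _ _ p n] by (auto simp: Z_index_def prime_to_def)
  then show "1 / (of_nat i * of_nat j * of_nat k) \<in> I 0"
    using inverse_in_I_0[of "i * j * k"] by simp
qed

end

theorem theorem2:
  fixes p q \<alpha> \<beta> :: nat
  assumes "prime p" and "prime q" and "odd p" and "odd q" and "p \<noteq> q"
    and "\<alpha> > 0" and "\<beta> > 0"
  shows "rat_cong_prime_power p \<alpha> (Z (p ^ \<alpha> * q ^ \<beta>))
    (2 * (2 - of_nat q) * (1 - 1 / of_nat q ^ 3)
      * of_nat p ^ (\<alpha> - 1) * of_nat q ^ (\<beta> - 1) * bernoulli (p - 3))"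
proof -
  interpret odd_prime p
    using assms(1,3) by unfold_locales
  obtain a b where ab: "\<alpha> = Suc a" "\<beta> = Suc b"
    using assms(6,7) by (metis gr0_conv_Suc)
  define N where "N = p ^ a * q ^ b"
  define C where "C = (2 * (2 - of_nat q) * (1 - 1 / of_nat q ^ 3) * bernoulli (p - 3) :: rat)"
  have cop: "coprime q p"
    using primes_coprime[OF assms(2,1)] assms(5) by simp
  have n: "p ^ \<alpha> * q ^ \<beta> = p * q * N"
    by (simp add: ab N_def)
  have "N dvd (p * q) ^ (a + b)"
    unfolding N_def power_mult_distrib by (intro mult_dvd_mono le_imp_power_dvd) auto
  then have 1: "Z (p * q * N) - of_nat N * Z (p * q) \<in> I (Suc a)"
    unfolding N_def using cop assms(2) by (intro Z_mult_cong) (auto simp: prime_gt_0_nat)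
  have "of_nat N \<in> I a"
    by (rule of_nat_in_I) (simp add: N_def)
  then have "of_nat N * (Z (p * q) - C) \<in> I (a + 1)"
    unfolding C_def by (intro I_mult Z_prime_product_cong assms(2) assms(5)[symmetric])
  then have "Z (p * q * N) - of_nat N * C \<in> I (Suc a)"
    using I_add[OF 1, of "of_nat N * (Z (p * q) - C)"] by (simp add: right_diff_distrib)
  moreover have "of_nat N * C \<in> I 0"
  proof -
    have "(1 / of_nat q) ^ 3 \<in> I 0"
      using cop by (intro I_power inverse_in_I_0)
    then show ?thesis
      unfolding C_def using bernoulli_in_I_0[of "p - 3"] p_gt_2
      by (intro I_0_mult I_diff) (auto simp: power_one_over)
  qed
  ultimately have "rat_cong_prime_power p (Suc a) (Z (p * q * N)) (of_nat N * C)"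
    by (intro rat_cong_prime_powerI Z_in_I_0) auto
  moreover have "of_nat N * C = 2 * (2 - of_nat q) * (1 - 1 / of_nat q ^ 3)
      * of_nat p ^ (\<alpha> - 1) * of_nat q ^ (\<beta> - 1) * bernoulli (p - 3)"
    by (simp add: N_def C_def ab)
  ultimately show ?thesis
    unfolding n by (simp only: ab)
qed

end
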